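(* Let $G\le \mathrm{Sym}_n$. Then there is a binary linear code $C\le\mathbb{F}_2^n$ which is self-dual and doubly-even with $G\le \mathrm{Aut}(C)$ if and only if the following three conditions hold: (a) $8\mid n$; (b) every self-dual simple $\mathbb{F}_2G$-module that is a composition factor of the permutation module $\mathbb{F}_2^n$ occurs with even multiplicity in a composition series of $\mathbb{F}_2^n$; (c) $G\le \mathrm{Alt}_n$.
   Context: $\mathrm{Sym}_n$ acts on $\mathbb{F}_2^n$ by permuting coordinates, making $\mathbb{F}_2^n$ an $\mathbb{F}_2G$-module. A code $C$ is self-dual if $C=C^\perp$ with respect to the standard scalar product $\sum x_iy_i$, and doubly-even if every codeword has Hamming weight divisible by $4$. $\mathrm{Aut}(C)=\{\pi\in\mathrm{Sym}_n\mid C\pi=C\}$. For a right $\mathbb{F}_2G$-module $S$, its dual is $S^*=\mathrm{Hom}_{\mathbb{F}_2}(S,\mathbb{F}_2)$ with $(fg)(s)=f(sg^{-1})$; $S$ is self-dual if $S\cong S^*$. *)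

theory Defs
  imports "HOL-Algebra.Module" "HOL-Algebra.AbelCoset" "HOL-Algebra.Sym_Groups" "HOL-Library.Z2"
begin

section \<open>Modules over the group algebra of a group over the field with two elements\<close>

definition F2 :: "bit ring" where
  "F2 = \<lparr>carrier = UNIV, monoid.mult = (*), one = 1, ring.zero = 0, add = (+)\<rparr>"

text \<open>A right module over the group algebra of \<open>G\<close> is given by its underlying vector space over
  \<open>F2\<close> together with the linear right action of the elements of \<open>G\<close>. (The fields \<open>mult\<close> and
  \<open>one\<close> that a \<open>module\<close> record inherits from \<open>ring\<close> play no role.)\<close>

record ('m, 'g) gmodule = "(bit, 'm) module" +
  act :: "'m \<Rightarrow> 'g \<Rightarrow> 'm"

locale F2G_module = module F2 M + grp: group G
  for G :: "('g, 'c) monoid_scheme" and M :: "('m, 'g, 'd) gmodule_scheme" +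
  assumes act_closed: "\<lbrakk>x \<in> carrier M; g \<in> carrier G\<rbrakk> \<Longrightarrow> act M x g \<in> carrier M"
    and act_add: "\<lbrakk>x \<in> carrier M; y \<in> carrier M; g \<in> carrier G\<rbrakk>
      \<Longrightarrow> act M (x \<oplus>\<^bsub>M\<^esub> y) g = act M x g \<oplus>\<^bsub>M\<^esub> act M y g"
    and act_smult: "\<lbrakk>x \<in> carrier M; g \<in> carrier G\<rbrakk>
      \<Longrightarrow> act M (a \<odot>\<^bsub>M\<^esub> x) g = a \<odot>\<^bsub>M\<^esub> act M x g"
    and act_one: "x \<in> carrier M \<Longrightarrow> act M x \<one>\<^bsub>G\<^esub> = x"
    and act_mult: "\<lbrakk>x \<in> carrier M; g \<in> carrier G; h \<in> carrier G\<rbrakk>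
      \<Longrightarrow> act M x (g \<otimes>\<^bsub>G\<^esub> h) = act M (act M x g) h"

definition F2G_submodule ::
  "('g, 'c) monoid_scheme \<Rightarrow> 'm set \<Rightarrow> ('m, 'g, 'd) gmodule_scheme \<Rightarrow> bool" where
  "F2G_submodule G H M \<longleftrightarrow>
     submodule H F2 M \<and> (\<forall>x\<in>H. \<forall>g\<in>carrier G. act M x g \<in> H)"

definition F2G_iso ::
  "('g, 'c) monoid_scheme \<Rightarrow> ('m, 'g, 'd) gmodule_scheme \<Rightarrow> ('n, 'g, 'e) gmodule_scheme \<Rightarrow> bool"
  where
  "F2G_iso G M N \<longleftrightarrow> (\<exists>\<phi>. bij_betw \<phi> (carrier M) (carrier N) \<and>
     (\<forall>x\<in>carrier M. \<forall>y\<in>carrier M. \<phi> (x \<oplus>\<^bsub>M\<^esub> y) = \<phi> x \<oplus>\<^bsub>N\<^esub> \<phi> y) \<and>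
     (\<forall>a. \<forall>x\<in>carrier M. \<phi> (a \<odot>\<^bsub>M\<^esub> x) = a \<odot>\<^bsub>N\<^esub> \<phi> x) \<and>
     (\<forall>x\<in>carrier M. \<forall>g\<in>carrier G. \<phi> (act M x g) = act N (\<phi> x) g))"

definition simple_F2G_module ::
  "('g, 'c) monoid_scheme \<Rightarrow> ('m, 'g, 'd) gmodule_scheme \<Rightarrow> bool" where
  "simple_F2G_module G M \<longleftrightarrow> F2G_module G M \<and> carrier M \<noteq> {\<zero>\<^bsub>M\<^esub>} \<and>
     (\<forall>H. F2G_submodule G H M \<longrightarrow> H = {\<zero>\<^bsub>M\<^esub>} \<or> H = carrier M)"

text \<open>In the scalar multiplication \<open>N\<close> is added because, for \<open>a = 0\<close>, the elementwise
  multiple of a coset by \<open>a\<close> is only \<open>{0}\<close> and not the coset \<open>N\<close>.\<close>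

definition quot_module ::
  "('m, 'g, 'd) gmodule_scheme \<Rightarrow> 'm set \<Rightarrow> ('m set, 'g) gmodule" where
  "quot_module M N = \<lparr>carrier = a_rcosets\<^bsub>M\<^esub> N, monoid.mult = undefined, one = undefined,
     ring.zero = N, add = set_add M,
     smult = (\<lambda>a X. N <+>\<^bsub>M\<^esub> ((\<lambda>x. a \<odot>\<^bsub>M\<^esub> x) ` X)),
     act = (\<lambda>X g. (\<lambda>x. act M x g) ` X)\<rparr>"

text \<open>The space of linear maps from \<open>S\<close> to \<open>F2\<close>; such maps are represented by functions that
  are \<open>undefined\<close> outside \<open>carrier S\<close>.\<close>

definition dual_module ::
  "('g, 'c) monoid_scheme \<Rightarrow> ('m, 'g, 'd) gmodule_scheme \<Rightarrow> ('m \<Rightarrow> bit, 'g) gmodule" where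
  "dual_module G S = \<lparr>carrier = {f \<in> extensional (carrier S).
       (\<forall>x\<in>carrier S. \<forall>y\<in>carrier S. f (x \<oplus>\<^bsub>S\<^esub> y) = f x + f y) \<and>
       (\<forall>a. \<forall>x\<in>carrier S. f (a \<odot>\<^bsub>S\<^esub> x) = a * f x)},
     monoid.mult = undefined, one = undefined,
     ring.zero = (\<lambda>s\<in>carrier S. 0),
     add = (\<lambda>f h. \<lambda>s\<in>carrier S. f s + h s),
     smult = (\<lambda>a f. \<lambda>s\<in>carrier S. a * f s),
     act = (\<lambda>f g. \<lambda>s\<in>carrier S. f (act S s (inv\<^bsub>G\<^esub> g)))\<rparr>"

definition self_dual_module ::
  "('g, 'c) monoid_scheme \<Rightarrow> ('m, 'g, 'd) gmodule_scheme \<Rightarrow> bool" where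
  "self_dual_module G S \<longleftrightarrow> F2G_iso G S (dual_module G S)"

subsection \<open>Composition series\<close>

definition series_factor ::
  "('m, 'g, 'd) gmodule_scheme \<Rightarrow> 'm set list \<Rightarrow> nat \<Rightarrow> ('m set, 'g) gmodule" where
  "series_factor M Vs i = quot_module (M\<lparr>carrier := Vs ! Suc i\<rparr>) (Vs ! i)"

definition composition_series ::
  "('g, 'c) monoid_scheme \<Rightarrow> ('m, 'g, 'd) gmodule_scheme \<Rightarrow> 'm set list \<Rightarrow> bool" where
  "composition_series G M Vs \<longleftrightarrow>
     Vs \<noteq> [] \<and> hd Vs = {\<zero>\<^bsub>M\<^esub>} \<and> last Vs = carrier M \<and>
     (\<forall>V\<in>set Vs. F2G_submodule G V M) \<and>
     (\<forall>i. Suc i < length Vs \<longrightarrow>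
        Vs ! i \<subseteq> Vs ! Suc i \<and> simple_F2G_module G (series_factor M Vs i))"

definition multiplicity_in_series ::
  "('g, 'c) monoid_scheme \<Rightarrow> ('n, 'g, 'e) gmodule_scheme \<Rightarrow> ('m, 'g, 'd) gmodule_scheme
     \<Rightarrow> 'm set list \<Rightarrow> nat" where
  "multiplicity_in_series G S M Vs =
     card {i. Suc i < length Vs \<and> F2G_iso G S (series_factor M Vs i)}"

definition composition_factor ::
  "('g, 'c) monoid_scheme \<Rightarrow> ('n, 'g, 'e) gmodule_scheme \<Rightarrow> ('m, 'g, 'd) gmodule_scheme \<Rightarrow> bool"
  where
  "composition_factor G S M \<longleftrightarrow>
     (\<exists>Vs i. composition_series G M Vs \<and> Suc i < length Vs \<and> F2G_iso G S (series_factor M Vs i))"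

section \<open>The permutation module and binary codes\<close>

text \<open>The vectors of length \<open>n\<close> are the functions that vanish outside \<open>{1..n}\<close>. Since
  \<open>sym_group\<close> multiplies by composition \<open>(p \<circ> q) i = p (q i)\<close>, the right action permuting the
  coordinates is \<open>(x p) i = x (p i)\<close>, that is \<open>x p = x \<circ> p\<close>. (If permutations are multiplied from
  left to right, it is \<open>x p = x \<circ> p\<^sup>-\<^sup>1\<close>; inversion identifies the two conventions and maps each
  subgroup to itself.)\<close>

definition perm_module :: "nat \<Rightarrow> (nat \<Rightarrow> bit, nat \<Rightarrow> nat) gmodule" where
  "perm_module n = \<lparr>carrier = {x. \<forall>i. i \<notin> {1..n} \<longrightarrow> x i = 0},
     monoid.mult = undefined, one = undefined,
     ring.zero = (\<lambda>i. 0),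
     add = (\<lambda>x y i. x i + y i),
     smult = (\<lambda>a x i. a * x i),
     act = (\<lambda>x p. x \<circ> p)\<rparr>"

definition linear_code :: "nat \<Rightarrow> (nat \<Rightarrow> bit) set \<Rightarrow> bool" where
  "linear_code n C \<longleftrightarrow> submodule C F2 (perm_module n)"

definition dual_code :: "nat \<Rightarrow> (nat \<Rightarrow> bit) set \<Rightarrow> (nat \<Rightarrow> bit) set" where
  "dual_code n C = {x \<in> carrier (perm_module n). \<forall>c\<in>C. (\<Sum>i=1..n. x i * c i) = 0}"

definition self_dual_code :: "nat \<Rightarrow> (nat \<Rightarrow> bit) set \<Rightarrow> bool" where
  "self_dual_code n C \<longleftrightarrow> C = dual_code n C"

definition hamming_weight :: "nat \<Rightarrow> (nat \<Rightarrow> bit) \<Rightarrow> nat" where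
  "hamming_weight n x = card {i \<in> {1..n}. x i \<noteq> 0}"

definition doubly_even_code :: "nat \<Rightarrow> (nat \<Rightarrow> bit) set \<Rightarrow> bool" where
  "doubly_even_code n C \<longleftrightarrow> (\<forall>c\<in>C. 4 dvd hamming_weight n c)"

definition Aut_code :: "nat \<Rightarrow> (nat \<Rightarrow> bit) set \<Rightarrow> (nat \<Rightarrow> nat) set" where
  "Aut_code n C = {p \<in> carrier (sym_group n). (\<lambda>c. act (perm_module n) c p) ` C = C}"

end

theory Submission
  imports Defs Complex_Main "HOL-Computational_Algebra.Primes"
    "HOL-Library.Function_Algebras" "HOL-Library.Set_Algebras"
begin

text \<open>
  Write \<open>b\<close> for the standard scalar product on \<open>V = F2^n\<close>.

  Necessity. Let \<open>C\<close> be a \<open>G\<close>-invariant, self-dual and doubly-even code. As \<open>V/C\<close> is dual to \<open>C\<close>, a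
  self-dual simple module has the same multiplicity in \<open>C\<close> and in \<open>V/C\<close>. The sum of \<open>\<i>^wt(x)\<close>
  over all \<open>x\<close> is \<open>(1 + \<i>)^n\<close>, and only the elements of the dual of \<open>C\<close> contribute to it; so
  \<open>(1 + \<i>)^n = card C > 0\<close>, which gives \<open>8 dvd n\<close>. If \<open>C\<close> and \<open>D\<close> are self-dual and doubly-even,
  then a transposition applied to \<open>D\<close> changes the dimension of \<open>C \<inter> D\<close> by exactly one, hence only
  even permutations can fix \<open>C\<close>.

  Sufficiency. Let \<open>D\<close> be a maximal \<open>G\<close>-invariant self-orthogonal code with dual \<open>D' \<noteq> D\<close>. A simple
  submodule \<open>A/D\<close> of \<open>D'/D\<close> is nondegenerate, hence self-dual and of even multiplicity, so its
  orthogonal complement contains a nondegenerate isomorphic copy \<open>B/D\<close>. The two forms differ by an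
  automorphism of a simple module in characteristic two, which has odd order and thus is a square;
  an isometry \<open>A/D \<rightarrow> B/D\<close> results, and its graph enlarges \<open>D\<close>. Therefore \<open>D\<close> is self-dual.
  If \<open>D\<close> is not doubly-even, its doubly-even subcode lies in exactly two doubly-even self-dual
  codes, and the even permutations in \<open>G\<close> cannot interchange them.
\<close>

section \<open>Arithmetic in characteristic two and the sign character\<close>

declare add_bit_eq_xor [simp del] mult_bit_eq_and [simp del]

lemma bit_fun_add_self [simp]: "x + x = (0 :: 'a \<Rightarrow> bit)"
  by (simp add: fun_eq_iff)

lemma bit_fun_add_self_left [simp]: "x + (x + y) = (y :: 'a \<Rightarrow> bit)"
  by (simp add: add.assoc [symmetric])

text \<open>The nontrivial additive character of the field with two elements. Its values are complex
  so that it can be multiplied with powers of \<i>.\<close>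

definition chi :: "bit \<Rightarrow> complex" where
  "chi b = (if b = 0 then 1 else - 1)"

lemma chi_0 [simp]: "chi 0 = 1"
  by (simp add: chi_def)

lemma chi_add: "chi (a + b) = chi a * chi b"
  by (cases a; cases b) (simp_all add: chi_def)

lemma chi_sum: "finite A \<Longrightarrow> chi (\<Sum>i\<in>A. f i) = (\<Prod>i\<in>A. chi (f i))"
  by (induction A rule: finite_induct) (simp_all add: chi_add chi_0)

lemma chi_eq_1_iff: "chi a = 1 \<longleftrightarrow> a = 0"
  by (simp add: chi_def)

text \<open>Orthogonality of characters: if \<open>f y = 1\<close> for some
  \<open>y \<in> H\<close>, translation by \<open>y\<close> permutes \<open>H\<close> and negates
  every summand, so the sum equals its own negative.\<close>

lemma sum_chi:
  fixes H :: "('a \<Rightarrow> bit) set"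
  assumes "finite H" and closed: "\<And>x y. x \<in> H \<Longrightarrow> y \<in> H \<Longrightarrow> x + y \<in> H"
    and add: "\<And>x y. x \<in> H \<Longrightarrow> y \<in> H \<Longrightarrow> f (x + y) = f x + f y"
  shows "(\<Sum>x\<in>H. chi (f x)) = (if \<forall>x\<in>H. f x = 0 then of_nat (card H) else 0)"
proof (cases "\<forall>x\<in>H. f x = 0")
  case True
  then show ?thesis by (simp add: chi_def)
next
  case False
  then obtain y where y: "y \<in> H" "f y = 1" by auto
  have "(\<Sum>x\<in>H. chi (f x)) = (\<Sum>x\<in>H. chi (f (x + y)))"
    by (rule sum.reindex_bij_witness [of _ "\<lambda>x. x + y" "\<lambda>x. x + y"])
      (auto simp: closed y add.assoc)
  also have "\<dots> = (\<Sum>x\<in>H. - chi (f x))"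
    by (rule sum.cong) (simp_all add: add y chi_add, simp add: chi_def)
  finally have "(\<Sum>x\<in>H. chi (f x)) = 0" by (simp add: sum_negf)
  with False show ?thesis by (simp only: if_False)
qed

section \<open>Binary codes\<close>

locale coordinates =
  fixes n :: nat
begin

abbreviation V :: "(nat \<Rightarrow> bit) set" where
  "V \<equiv> carrier (perm_module n)"

abbreviation perp :: "(nat \<Rightarrow> bit) set \<Rightarrow> (nat \<Rightarrow> bit) set" where
  "perp \<equiv> dual_code n"

definition dot :: "(nat \<Rightarrow> bit) \<Rightarrow> (nat \<Rightarrow> bit) \<Rightarrow> bit" where
  "dot x y = (\<Sum>i=1..n. x i * y i)"

text \<open>Over the field with two elements an additive subgroup is a subspace, and it contains
  negatives because \<open>x + x = 0\<close>.\<close>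

definition lin :: "(nat \<Rightarrow> bit) set \<Rightarrow> bool" where
  "lin H \<longleftrightarrow> H \<subseteq> V \<and> 0 \<in> H \<and> (\<forall>x\<in>H. \<forall>y\<in>H. x + y \<in> H)"

lemma mem_V_iff: "x \<in> V \<longleftrightarrow> (\<forall>i. i \<notin> {1..n} \<longrightarrow> x i = 0)"
  by (simp add: perm_module_def)

lemma zero_in_V [simp]: "0 \<in> V"
  by (simp add: mem_V_iff)

lemma add_in_V: "x \<in> V \<Longrightarrow> y \<in> V \<Longrightarrow> x + y \<in> V"
  by (simp add: mem_V_iff)

lemma lin_V: "lin V"
  by (simp add: lin_def add_in_V)

lemma lin_zero: "lin {0}"
  by (simp add: lin_def)

lemma linD:
  assumes "lin H"
  shows "H \<subseteq> V" "0 \<in> H" "\<And>x y. x \<in> H \<Longrightarrow> y \<in> H \<Longrightarrow> x + y \<in> H"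
  using assms by (auto simp: lin_def)

lemma lin_add_cancel: "lin H \<Longrightarrow> x \<in> H \<Longrightarrow> x + y \<in> H \<longleftrightarrow> y \<in> H"
  by (metis linD(3) bit_fun_add_self_left)

lemma lin_add_cancel': "lin H \<Longrightarrow> y \<in> H \<Longrightarrow> x + y \<in> H \<longleftrightarrow> x \<in> H"
  by (metis lin_add_cancel add.commute)

lemma lin_Int: "lin A \<Longrightarrow> lin B \<Longrightarrow> lin (A \<inter> B)"
  by (auto simp: lin_def)

lemma lin_plus:
  assumes "lin A" "lin B"
  shows "lin (A + B)"
  unfolding lin_def
proof (intro conjI ballI subsetI)
  fix x assume "x \<in> A + B"
  then show "x \<in> V" using assms linD(1) by (blast intro: add_in_V elim: set_plus_elim)
next
  show "0 \<in> A + B" using assms set_plus_intro [of 0 A 0 B] by (simp add: lin_def)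
next
  fix x y assume "x \<in> A + B" "y \<in> A + B"
  then obtain a b a' b' where *: "a \<in> A" "b \<in> B" "x = a + b" "a' \<in> A" "b' \<in> B" "y = a' + b'"
    by (auto elim!: set_plus_elim)
  then have "(a + a') + (b + b') \<in> A + B" using assms by (intro set_plus_intro) (auto simp: lin_def)
  then show "x + y \<in> A + B" using * by (simp add: ac_simps)
qed

lemma subset_plus1: "lin B \<Longrightarrow> A \<subseteq> A + B"
  using set_plus_intro [of _ A 0 B] by (auto simp: lin_def)

lemma subset_plus2: "lin A \<Longrightarrow> B \<subseteq> A + B"
  using set_plus_intro [of 0 A _ B] by (auto simp: lin_def)

lemma plus_subset: "lin C \<Longrightarrow> A \<subseteq> C \<Longrightarrow> B \<subseteq> C \<Longrightarrow> A + B \<subseteq> C"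
  by (blast dest: linD(3) elim: set_plus_elim)

text \<open>Vectors vanish outside \<open>{1..n}\<close>, whereas elements of \<open>PiE\<close> are
  \<open>undefined\<close> there. Changing this default value makes counting and the exchange of
  products with sums available for \<open>V\<close>.\<close>

lemma bij_betw_V_PiE: "bij_betw (\<lambda>x. restrict x {1..n}) V (PiE {1..n} (\<lambda>_. UNIV))"
  by (rule bij_betw_byWitness [where f' = "\<lambda>x i. if i \<in> {1..n} then x i else 0"])
    (auto simp: mem_V_iff fun_eq_iff restrict_def PiE_def extensional_def)

lemma UNIV_bit: "(UNIV :: bit set) = {0, 1}"
  by (auto intro: bit.exhaust)

lemma finite_bit [simp]: "finite (A :: bit set)"
  by (rule finite_subset [OF subset_UNIV]) (simp add: UNIV_bit)

lemma finite_V [simp]: "finite V"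
  using bij_betw_finite [OF bij_betw_V_PiE] by (simp add: finite_PiE)

lemma card_V: "card V = 2 ^ n"
  using bij_betw_same_card [OF bij_betw_V_PiE] by (simp add: card_PiE UNIV_bit numeral_2_eq_2)

lemma finite_lin [simp]: "lin H \<Longrightarrow> finite H"
  using finite_subset [OF _ finite_V] by (auto simp: lin_def)

section \<open>The standard scalar product and dual codes\<close>

lemma dot_commute: "dot x y = dot y x"
  by (simp add: dot_def mult.commute)

lemma dot_add_left: "dot (x + y) z = dot x z + dot y z"
  by (simp add: dot_def distrib_right sum.distrib)

lemma dot_add_right: "dot x (y + z) = dot x y + dot x z"
  by (simp add: dot_def distrib_left sum.distrib)

lemma dot_0 [simp]: "dot 0 x = 0" "dot x 0 = 0"
  by (simp_all add: dot_def)

lemma perp_def: "perp C = {x \<in> V. \<forall>c\<in>C. dot x c = 0}"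
  by (simp add: dual_code_def dot_def)

lemma lin_perp [simp]: "lin (perp C)"
  by (simp add: lin_def perp_def add_in_V dot_add_left subset_eq)

lemma perp_anti: "A \<subseteq> B \<Longrightarrow> perp B \<subseteq> perp A"
  by (auto simp: perp_def)

lemma subset_perp_perp: "A \<subseteq> V \<Longrightarrow> A \<subseteq> perp (perp A)"
  by (auto simp: perp_def dot_commute)

definition single :: "nat \<Rightarrow> nat \<Rightarrow> bit" where
  "single i = (\<lambda>j. if j = i then 1 else 0)"

lemma single_in_V: "i \<in> {1..n} \<Longrightarrow> single i \<in> V"
  by (simp add: mem_V_iff single_def)

lemma dot_single: "i \<in> {1..n} \<Longrightarrow> dot x (single i) = x i"
  by (simp add: dot_def single_def if_distrib cong: if_cong)

lemma dot_nondegenerate: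
  assumes "x \<in> V" "\<And>y. y \<in> V \<Longrightarrow> dot x y = 0"
  shows "x = 0"
proof
  fix i
  show "x i = 0 i"
    using assms(2) [OF single_in_V] assms(1) by (cases "i \<in> {1..n}") (auto simp: dot_single mem_V_iff)
qed

lemma perp_zero [simp]: "perp {0} = V"
  by (auto simp: perp_def)

lemma perp_V [simp]: "perp V = {0}"
  using dot_nondegenerate by (auto simp: perp_def)

text \<open>The character sum over all pairs from \<open>V\<close> and \<open>A\<close> is evaluated
  twice: summing over \<open>A\<close> first leaves only \<open>perp A\<close>, summing over
  \<open>V\<close> first leaves only \<open>a = 0\<close> by nondegeneracy.\<close>

lemma card_mult_card_perp:
  assumes A: "lin A"
  shows "card A * card (perp A) = 2 ^ n"
proof -
  have "(\<Sum>x\<in>V. \<Sum>a\<in>A. chi (dot x a)) = (\<Sum>x\<in>V. if x \<in> perp A then of_nat (card A) else 0)"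
    using A by (intro sum.cong refl, subst sum_chi) (auto simp: dot_add_right linD perp_def)
  also have "\<dots> = of_nat (card A * card (perp A))"
    by (simp add: sum.If_cases Int_absorb1 linD(1) mult.commute)
  finally have 1: "(\<Sum>x\<in>V. \<Sum>a\<in>A. chi (dot x a)) = of_nat (card A * card (perp A))" .
  have "(\<Sum>x\<in>V. \<Sum>a\<in>A. chi (dot x a)) = (\<Sum>a\<in>A. \<Sum>x\<in>V. chi (dot x a))"
    by (rule sum.swap)
  also have "\<dots> = (\<Sum>a\<in>A. if a = 0 then of_nat (card V) else 0)"
  proof (intro sum.cong refl)
    fix a assume "a \<in> A"
    then have "a \<in> V" using A linD(1) by blast
    then have "(\<forall>x\<in>V. dot x a = 0) \<longleftrightarrow> a = 0"
      using dot_nondegenerate [of a] by (auto simp: dot_commute)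
    then show "(\<Sum>x\<in>V. chi (dot x a)) = (if a = 0 then of_nat (card V) else 0)"
      by (subst sum_chi) (auto simp: dot_add_left add_in_V)
  qed
  also have "\<dots> = of_nat (card V)"
    using A by (simp add: linD)
  finally have "(of_nat (card A * card (perp A)) :: complex) = of_nat (card V)"
    using 1 by simp
  then show ?thesis
    by (simp only: of_nat_eq_iff card_V)
qed

text \<open>Applying \<open>card_mult_card_perp\<close> to \<open>A\<close> and to
  \<open>perp A\<close> shows that \<open>A\<close> and its double dual have equal size, and one
  contains the other.\<close>

lemma perp_perp [simp]:
  assumes "lin A"
  shows "perp (perp A) = A"
proof -
  have "card (perp A) * card (perp (perp A)) = card A * card (perp A)"
    using card_mult_card_perp [OF assms] card_mult_card_perp [of "perp A"] by simp
  moreover have "card (perp A) \<noteq> 0"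
    using card_mult_card_perp [OF assms] by (metis mult_0_right power_not_zero zero_neq_numeral)
  ultimately have "card A = card (perp (perp A))" by simp
  moreover have "A \<subseteq> perp (perp A)" using assms subset_perp_perp linD(1) by blast
  ultimately show ?thesis by (metis card_subset_eq finite_lin lin_perp)
qed

lemma perp_plus:
  assumes "lin A" "lin B"
  shows "perp (A + B) = perp A \<inter> perp B"
proof
  show "perp (A + B) \<subseteq> perp A \<inter> perp B"
    using perp_anti [OF subset_plus1 [OF assms(2), of A]] perp_anti [OF subset_plus2 [OF assms(1), of B]]
    by blast
  show "perp A \<inter> perp B \<subseteq> perp (A + B)"
    by (auto simp: perp_def dot_add_right elim!: set_plus_elim)
qed

lemma perp_Int:
  assumes "lin A" "lin B"
  shows "perp (A \<inter> B) = perp A + perp B"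
  using perp_plus [of "perp A" "perp B"] assms perp_perp [of "perp A + perp B"]
  by (simp add: lin_plus)

lemma card_self_dual:
  assumes "lin C" "perp C = C"
  shows "card C ^ 2 = 2 ^ n"
  using card_mult_card_perp [OF assms(1)] assms(2) by (simp add: power2_eq_square)

lemma self_dual_if_card:
  assumes "lin C" "C \<subseteq> perp C" "card C ^ 2 = 2 ^ n"
  shows "perp C = C"
proof -
  have "card C * card (perp C) = card C * card C"
    using card_mult_card_perp [OF assms(1)] assms(3) by (simp add: power2_eq_square)
  moreover have "card C \<noteq> 0" using assms(3) by (metis power_not_zero zero_neq_numeral zero_power2)
  ultimately show ?thesis using card_subset_eq [OF finite_lin [OF lin_perp] assms(2)] by simp
qed

text \<open>The kernel \<open>K\<close> of a nonzero functional is properly contained in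
  \<open>A\<close>, so some \<open>y\<close> lies in \<open>perp K\<close> but not in
  \<open>perp A\<close>. Both \<open>f\<close> and \<open>dot y\<close> vanish on \<open>K\<close>
  and are nonzero on the other coset, hence agree.\<close>

lemma linear_functional_dot:
  assumes A: "lin A" and add: "\<And>x y. x \<in> A \<Longrightarrow> y \<in> A \<Longrightarrow> f (x + y) = f x + f y"
  obtains y where "y \<in> V" "\<And>x. x \<in> A \<Longrightarrow> f x = dot y x"
proof (cases "\<forall>x\<in>A. f x = 0")
  case True
  then show ?thesis using that [of 0] by simp
next
  case False
  then obtain z where z: "z \<in> A" "f z = 1" by auto
  define K where "K = {x \<in> A. f x = 0}"
  have f0: "f 0 = 0" using add [of 0 0] linD(2) [OF A] by simp
  have K: "lin K" using A by (auto simp: lin_def K_def add f0)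
  have "z \<notin> K" using z by (simp add: K_def)
  have "\<not> perp K \<subseteq> perp A"
    using perp_anti [of "perp K" "perp A"] A K z \<open>z \<notin> K\<close> by auto
  then obtain y where y: "y \<in> perp K" "y \<notin> perp A" by blast
  have "dot y z = 1"
  proof (rule ccontr)
    assume "dot y z \<noteq> 1"
    then have 0: "dot y z = 0" by simp
    have "dot y x = 0" if "x \<in> A" for x
    proof (cases "f x = 0")
      case True
      then show ?thesis using y that by (auto simp: K_def perp_def)
    next
      case False
      then have "x + z \<in> K" using that z A by (simp add: K_def add linD(3))
      then have "dot y (x + z) = 0" using y by (auto simp: perp_def)
      then show ?thesis using 0 by (simp add: dot_add_right)
    qed
    then show False using y by (auto simp: perp_def)
  qed
  have "f x = dot y x" if "x \<in> A" for x
  proof (cases "f x = 0")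
    case True
    then show ?thesis using y that by (auto simp: K_def perp_def)
  next
    case False
    then have "x + z \<in> K" using that z A by (simp add: K_def add linD(3))
    then have "dot y (x + z) = 0" using y by (auto simp: perp_def)
    then show ?thesis using \<open>dot y z = 1\<close> False by (cases "dot y x") (simp_all add: dot_add_right)
  qed
  then show ?thesis using that y by (auto simp: perp_def)
qed

subsection \<open>Weights modulo four\<close>

text \<open>The weight modulo four as a fourth root of unity. In product form, sums over
  \<open>V\<close> factor over the coordinates.\<close>

definition iota :: "(nat \<Rightarrow> bit) \<Rightarrow> complex" where
  "iota x = (\<Prod>i=1..n. if x i = 0 then 1 else \<i>)"

lemma iota_hamming_weight: "iota x = \<i> ^ hamming_weight n x"
proof -
  have "{1..n} \<inter> - {i. x i = 0} = {i \<in> {1..n}. x i \<noteq> 0}" by auto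
  then show ?thesis by (simp add: iota_def hamming_weight_def prod.If_cases)
qed

lemma i_power_eq_1_iff: "\<i> ^ k = 1 \<longleftrightarrow> 4 dvd k"
proof -
  have "\<i> ^ k = \<i> ^ (4 * (k div 4) + k mod 4)" by simp
  also have "\<dots> = \<i> ^ (k mod 4)" by (simp only: power_add power_mult) simp
  finally have *: "\<i> ^ k = \<i> ^ (k mod 4)" .
  have "k mod 4 < 4" by simp
  then have "k mod 4 = 0 \<or> k mod 4 = 1 \<or> k mod 4 = 2 \<or> k mod 4 = 3" by linarith
  then show ?thesis unfolding * dvd_eq_mod_eq_0
    by (elim disjE) (simp_all add: power3_eq_cube complex_eq_iff)
qed

lemma iota_eq_1_iff: "iota x = 1 \<longleftrightarrow> 4 dvd hamming_weight n x"
  by (simp add: iota_hamming_weight i_power_eq_1_iff)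

lemma doubly_even_code_iff: "doubly_even_code n C \<longleftrightarrow> (\<forall>c\<in>C. iota c = 1)"
  by (simp add: doubly_even_code_def iota_eq_1_iff)

lemma iota_0 [simp]: "iota 0 = 1"
  by (simp add: iota_def)

text \<open>The weight of \<open>x + y\<close> is the sum of the weights minus twice the size of the
  common support, and each common coordinate contributes a sign \<open>-1\<close>. Thus
  \<open>iota\<close> behaves like a quadratic form with polarization \<open>dot\<close>.\<close>

lemma iota_add: "iota (x + y) = iota x * iota y * chi (dot x y)"
proof -
  have "(if (x + y) i = 0 then 1 else \<i>)
      = (if x i = 0 then 1 else \<i>) * (if y i = 0 then 1 else \<i>) * chi (x i * y i)" for i
    by (cases "x i"; cases "y i") (simp_all add: chi_def)
  then show ?thesis
    by (simp only: iota_def dot_def chi_sum [OF finite_atLeastAtMost] prod.distrib)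
qed

lemma sum_iota_V: "(\<Sum>x\<in>V. iota x) = (1 + \<i>) ^ n"
proof -
  have "(\<Sum>x\<in>V. iota x)
      = (\<Sum>x\<in>PiE {1..n} (\<lambda>_. UNIV). \<Prod>i=1..n. if x i = (0 :: bit) then 1 else \<i>)"
    by (subst sum.reindex_bij_betw [OF bij_betw_V_PiE, symmetric]) (simp add: iota_def)
  also have "\<dots> = (\<Prod>i=1..n. \<Sum>b\<in>UNIV. if b = (0 :: bit) then 1 else \<i>)"
    by (rule prod_sum_PiE [symmetric]) simp_all
  finally show ?thesis by (simp add: UNIV_bit)
qed

definition doubly_even :: "(nat \<Rightarrow> bit) set \<Rightarrow> bool" where
  "doubly_even C \<longleftrightarrow> lin C \<and> (\<forall>c\<in>C. iota c = 1)"

lemma doubly_even_self_orthogonal: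
  assumes "doubly_even C"
  shows "C \<subseteq> perp C"
proof -
  have "dot x y = 0" if "x \<in> C" "y \<in> C" for x y
    using iota_add [of x y] assms that by (auto simp: doubly_even_def linD(3) chi_eq_1_iff)
  then show ?thesis using assms by (auto simp: doubly_even_def perp_def dest: linD(1))
qed

text \<open>The sum over \<open>V\<close> is averaged over translations by \<open>C\<close>.
  Translation by \<open>c \<in> C\<close> multiplies \<open>iota x\<close> by
  \<open>chi (dot x c)\<close>, and orthogonality of characters removes all \<open>x\<close> outside
  \<open>perp C\<close>.\<close>

lemma sum_iota_perp:
  assumes "doubly_even C"
  shows "(\<Sum>x\<in>perp C. iota x) = (1 + \<i>) ^ n"
proof -
  have C: "lin C" "\<And>c. c \<in> C \<Longrightarrow> iota c = 1" using assms by (auto simp: doubly_even_def)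
  have "of_nat (card C) * (\<Sum>x\<in>V. iota x) = (\<Sum>c\<in>C. \<Sum>x\<in>V. iota x)" by simp
  also have "\<dots> = (\<Sum>c\<in>C. \<Sum>x\<in>V. iota (x + c))"
  proof (rule sum.cong [OF refl])
    fix c assume "c \<in> C"
    then have "c \<in> V" using linD(1) [OF C(1)] by blast
    then show "(\<Sum>x\<in>V. iota x) = (\<Sum>x\<in>V. iota (x + c))"
      by (intro sum.reindex_bij_witness [of _ "\<lambda>x. x + c" "\<lambda>x. x + c"])
        (auto simp: add_in_V add.assoc)
  qed
  also have "\<dots> = (\<Sum>c\<in>C. \<Sum>x\<in>V. iota x * chi (dot x c))"
    by (simp add: iota_add C)
  also have "\<dots> = (\<Sum>x\<in>V. iota x * (\<Sum>c\<in>C. chi (dot x c)))"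
    by (subst sum.swap) (simp add: sum_distrib_left)
  also have "\<dots> = (\<Sum>x\<in>V. if x \<in> perp C then of_nat (card C) * iota x else 0)"
    using C(1) by (intro sum.cong refl, subst sum_chi) (auto simp: dot_add_right linD perp_def)
  also have "\<dots> = of_nat (card C) * (\<Sum>x\<in>perp C. iota x)"
    by (simp add: sum.If_cases Int_absorb1 linD(1) sum_distrib_left)
  finally show ?thesis
    using C(1) linD(2) [OF C(1)] by (auto simp: sum_iota_V)
qed

text \<open>Type II is the customary name for doubly-even self-dual binary codes.\<close>

definition type_II :: "(nat \<Rightarrow> bit) set \<Rightarrow> bool" where
  "type_II C \<longleftrightarrow> doubly_even C \<and> perp C = C"

text \<open>With \<open>card C = 2 ^ m\<close> and \<open>n = 2 * m\<close>, the Gauss sum reads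
  \<open>(1 + \<i>) ^ (2 * m) = 2 ^ m\<close>. Since \<open>(1 + \<i>) ^ 2 = 2 * \<i>\<close>, it
  follows that \<open>\<i> ^ m = 1\<close>, so four divides \<open>m\<close>.\<close>

lemma type_II_length:
  assumes "type_II C"
  shows "8 dvd n"
proof -
  have C: "doubly_even C" "perp C = C" "lin C" using assms by (auto simp: type_II_def doubly_even_def)
  have card: "card C ^ 2 = 2 ^ n" using C card_self_dual by blast
  have "(\<Sum>x\<in>perp C. iota x) = of_nat (card C)"
    using C by (simp add: doubly_even_def)
  then have g: "(1 + \<i>) ^ n = of_nat (card C)" using sum_iota_perp [OF C(1)] by simp
  have "card C dvd 2 ^ n" using card by (metis dvd_triv_left power2_eq_square)
  then obtain m where m: "card C = 2 ^ m"
    using divides_primepow_nat [of 2 "card C" n] two_is_prime_nat by auto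
  then have n: "n = 2 * m" using card by (simp add: power_mult [symmetric] mult.commute)
  have "(1 + \<i>) ^ 2 = 2 * \<i>" by (simp add: power2_eq_square complex_eq_iff)
  then have "(2 * \<i>) ^ m = 2 ^ m" using g unfolding m n power_mult by simp
  then have "\<i> ^ m = 1" by (simp add: power_mult_distrib)
  then show ?thesis using n i_power_eq_1_iff by auto
qed

subsection \<open>Permutations of the coordinates\<close>


abbreviation move :: "(nat \<Rightarrow> nat) \<Rightarrow> (nat \<Rightarrow> bit) set \<Rightarrow> (nat \<Rightarrow> bit) set" where
  "move p C \<equiv> (\<lambda>x. x \<circ> p) ` C"

lemma comp_add: "(x + y) \<circ> p = (x \<circ> p) + (y \<circ> p)" for x y :: "nat \<Rightarrow> bit"
  by (simp add: fun_eq_iff)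

lemma comp_zero [simp]: "(0 :: nat \<Rightarrow> bit) \<circ> p = 0"
  by (simp add: fun_eq_iff)

lemma comp_in_V:
  assumes "p permutes {1..n}" "x \<in> V"
  shows "x \<circ> p \<in> V"
  using assms(2) permutes_not_in [OF assms(1)] unfolding mem_V_iff o_apply by metis

lemma dot_comp: "p permutes {1..n} \<Longrightarrow> dot (x \<circ> p) (y \<circ> p) = dot x y"
  using sum.permute [of p "{1..n}" "\<lambda>i. x i * y i"] by (simp add: dot_def o_def)

lemma iota_comp: "p permutes {1..n} \<Longrightarrow> iota (x \<circ> p) = iota x"
  using prod.permute [of p "{1..n}" "\<lambda>i. if x i = 0 then 1 else \<i>"] by (simp add: iota_def o_def)

lemma comp_comp_inv [simp]:
  assumes "p permutes {1..n}"
  shows "x \<circ> p \<circ> inv' p = x" "x \<circ> inv' p \<circ> p = x"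
  by (simp_all add: comp_assoc permutes_inv_o [OF assms])

lemma inj_comp: "p permutes {1..n} \<Longrightarrow> inj_on (\<lambda>x. x \<circ> p) A"
  by (metis comp_comp_inv(1) inj_on_inverseI)

lemma card_move: "p permutes {1..n} \<Longrightarrow> card (move p C) = card C"
  by (simp add: card_image inj_comp)

lemma lin_move:
  assumes "p permutes {1..n}" "lin C"
  shows "lin (move p C)"
  unfolding lin_def
proof (intro conjI ballI)
  show "move p C \<subseteq> V" using assms comp_in_V linD(1) by blast
  show "0 \<in> move p C" using image_eqI [of 0 "\<lambda>x. x \<circ> p" 0 C] assms(2) by (simp add: linD)
next
  fix x y assume "x \<in> move p C" "y \<in> move p C"
  then show "x + y \<in> move p C" using assms(2) by (auto simp: comp_add [symmetric] linD)
qed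

lemma perp_move:
  assumes "p permutes {1..n}"
  shows "perp (move p C) = move p (perp C)"
proof
  show "move p (perp C) \<subseteq> perp (move p C)"
    using assms by (auto simp: perp_def comp_in_V dot_comp)
  show "perp (move p C) \<subseteq> move p (perp C)"
  proof
    fix x assume x: "x \<in> perp (move p C)"
    have "dot (x \<circ> inv' p) c = 0" if "c \<in> C" for c
    proof -
      have "dot (x \<circ> inv' p) c = dot x (c \<circ> p)"
        using dot_comp [OF assms, of "x \<circ> inv' p" c] assms by simp
      then show ?thesis using x that by (auto simp: perp_def)
    qed
    then have "x \<circ> inv' p \<in> perp C"
      using x comp_in_V [OF permutes_inv [OF assms]] by (simp add: perp_def)
    then have "(x \<circ> inv' p) \<circ> p \<in> move p (perp C)" by (rule imageI)
    then show "x \<in> move p (perp C)" using assms by simp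
  qed
qed

lemma type_II_move: "p permutes {1..n} \<Longrightarrow> type_II C \<Longrightarrow> type_II (move p C)"
  by (auto simp: type_II_def doubly_even_def lin_move perp_move iota_comp)

section \<open>Intersections of Type II codes under coordinate permutations\<close>

lemma card_index_2:
  assumes H: "lin H" and K: "K = {x \<in> H. dot x v = 0}" and ne: "\<exists>x\<in>H. dot x v \<noteq> 0"
  shows "card H = 2 * card K"
proof -
  obtain z where z: "z \<in> H" "dot z v = 1" using ne by auto
  have "H - K = (\<lambda>x. x + z) ` K"
  proof
    show "H - K \<subseteq> (\<lambda>x. x + z) ` K"
    proof
      fix x assume "x \<in> H - K"
      then have "x + z \<in> K" "x = (x + z) + z" using z H K
        by (auto simp: linD dot_add_left add.assoc)
      then show "x \<in> (\<lambda>x. x + z) ` K" by blast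
    qed
    show "(\<lambda>x. x + z) ` K \<subseteq> H - K" using z H K by (auto simp: linD dot_add_left)
  qed
  moreover have "inj_on (\<lambda>x. x + z) K" by (rule inj_onI) simp
  ultimately have "card (H - K) = card K" by (simp add: card_image)
  moreover have "card H = card K + card (H - K)"
    using H K by (subst card_Un_disjoint [symmetric]) (auto intro: arg_cong [of _ _ card] finite_subset [OF _ finite_lin])
  ultimately show ?thesis by simp
qed

text \<open>A transposition acts as the reflection in the vector of weight two supported on the two
  coordinates.\<close>

lemma comp_transpose:
  assumes "i \<noteq> j"
  shows "x \<circ> Transposition.transpose i j = (if x i = x j then x else x + (single i + single j))"
proof (rule ext)
  fix k
  show "(x \<circ> Transposition.transpose i j) k = (if x i = x j then x else x + (single i + single j)) k"
    using assms by (cases "x i"; cases "x j")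
      (auto simp: Transposition.transpose_def single_def)
qed

text \<open>Both intersections have the same part \<open>K\<close> orthogonal to \<open>v\<close>.
  Exactly one of them also contains a vector not orthogonal to \<open>v\<close>, and that one is
  twice as large as \<open>K\<close>.\<close>

lemma type_II_transpose:
  assumes C: "type_II C" and D: "type_II D" and ij: "i \<in> {1..n}" "j \<in> {1..n}" "i \<noteq> j"
  defines "D' \<equiv> move (Transposition.transpose i j) D"
  shows "card (C \<inter> D') = 2 * card (C \<inter> D) \<or> card (C \<inter> D) = 2 * card (C \<inter> D')"
proof -
  define v where "v = single i + single j"
  let ?t = "Transposition.transpose i j"
  have t: "?t permutes {1..n}" using ij by (simp add: permutes_swap_id)
  have C': "lin C" "perp C = C" "\<And>c. c \<in> C \<Longrightarrow> iota c = 1"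
    using C by (auto simp: type_II_def doubly_even_def)
  have D1: "lin D" "perp D = D" "\<And>c. c \<in> D \<Longrightarrow> iota c = 1"
    using D by (auto simp: type_II_def doubly_even_def)
  have D2: "lin D'" "perp D' = D'" "\<And>c. c \<in> D' \<Longrightarrow> iota c = 1"
    using type_II_move [OF t D] by (auto simp: type_II_def doubly_even_def D'_def)
  have orth: "dot x y = 0" if "x \<in> C" "y \<in> C" for x y
    using that C'(2) by (auto simp: perp_def)
  have v: "v \<in> V" using ij by (simp add: v_def single_in_V add_in_V)
  have dotv: "dot x v = x i + x j" for x using ij by (simp add: v_def dot_add_right dot_single)
  have xt: "x \<circ> ?t = (if dot x v = 0 then x else x + v)" for x
    unfolding comp_transpose [OF ij(3)] dotv v_def [symmetric] by (cases "x i"; cases "x j") simp_all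
  have vv: "dot v v = 0" using ij by (simp add: dotv, simp add: v_def single_def)
  have iv: "iota v = -1"
  proof -
    have "iota (single k) = \<i>" if "k \<in> {1..n}" for k
    proof -
      have "iota (single k) = (\<Prod>l=1..n. if l = k then \<i> else 1)"
        unfolding iota_def by (rule prod.cong) (simp_all add: single_def)
      then show ?thesis using that by (simp add: prod.delta)
    qed
    moreover have "dot (single i) (single j) = 0" using ij by (simp add: dot_single, simp add: single_def)
    ultimately show ?thesis using ij by (simp add: v_def iota_add)
  qed
  have vD: "v \<notin> D" using D1(3) iv by force
  have vD': "v \<notin> D'" using D2(3) iv by force
  have mem_D': "x \<in> D' \<longleftrightarrow> (if dot x v = 0 then x \<in> D else x + v \<in> D)" for x
  proof -
    have "x \<in> D' \<longleftrightarrow> x \<circ> ?t \<in> D"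
    proof
      assume "x \<in> D'"
      then show "x \<circ> ?t \<in> D" by (auto simp: D'_def comp_assoc)
    next
      assume "x \<circ> ?t \<in> D"
      then have "(x \<circ> ?t) \<circ> ?t \<in> D'" unfolding D'_def by (rule imageI)
      then show "x \<in> D'" by (simp add: comp_assoc)
    qed
    then show ?thesis by (simp add: xt)
  qed
  define K where "K = {x \<in> C \<inter> D. dot x v = 0}"
  \<comment> \<open>The transposition fixes every vector orthogonal to \<open>v\<close>, so
    \<open>D\<close> and \<open>D'\<close> agree on the hyperplane.\<close>
  have K': "K = {x \<in> C \<inter> D'. dot x v = 0}" by (auto simp: K_def mem_D')
  have lin: "lin (C \<inter> D)" "lin (C \<inter> D')" using C' D1 D2 lin_Int by auto
  show ?thesis
  proof (cases "\<exists>x\<in>C \<inter> D. dot x v \<noteq> 0")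
    case True
    then obtain x where x: "x \<in> C" "x \<in> D" "dot x v = 1" by auto
    \<comment> \<open>Not both intersections leave the hyperplane: \<open>x\<close> is orthogonal to
      \<open>y\<close> within \<open>C\<close> and to \<open>y + v\<close> within \<open>D\<close>,
      hence to \<open>v\<close>.\<close>
    have "dot y v = 0" if y: "y \<in> C" "y \<in> D'" for y
    proof (rule ccontr)
      assume 1: "dot y v \<noteq> 0"
      then have "y + v \<in> D" using y mem_D' by auto
      then have "dot x (y + v) = 0" using x D1(2) by (auto simp: perp_def)
      then show False using orth [OF x(1) y(1)] x(3) by (simp add: dot_add_right)
    qed
    then have "K = C \<inter> D'" using K' by auto
    then show ?thesis using card_index_2 [OF lin(1) K_def True] by simp
  next
    case False
    then have "K = C \<inter> D" by (auto simp: K_def)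
    have "v \<in> perp (C \<inter> D)" using False v by (auto simp: perp_def dot_commute)
    \<comment> \<open>Self-duality makes \<open>C + D\<close> the dual of
      \<open>C \<inter> D\<close>. Comparing weights modulo four in \<open>c = v + d\<close>, where
      \<open>v\<close> has weight two, forces \<open>d\<close> and then \<open>c\<close> to be
      non-orthogonal to \<open>v\<close>.\<close>
    then obtain c d where cd: "c \<in> C" "d \<in> D" "v = c + d"
      using perp_Int [of C D] C' D1 by (auto elim!: set_plus_elim)
    then have c: "c = v + d" by (simp add: add.assoc)
    have "iota c = iota v * iota d * chi (dot v d)" by (simp add: c iota_add)
    then have "chi (dot v d) = - 1" using C'(3) [OF cd(1)] D1(3) [OF cd(2)] iv
      by (simp add: equation_minus_iff)
    then have "dot d v = 1" by (cases "dot v d") (simp_all add: dot_commute)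
    then have "dot c v = 1" by (simp add: c dot_add_left vv)
    moreover have "c \<in> D'" using mem_D' [of c] \<open>dot c v = 1\<close> cd(2) by (simp add: c add.commute add.left_commute)
    ultimately have "\<exists>x\<in>C \<inter> D'. dot x v \<noteq> 0" using cd(1) by (intro bexI [of _ c]) auto
    then show ?thesis using card_index_2 [OF lin(2) K'] \<open>K = C \<inter> D\<close> by simp
  qed
qed

text \<open>The dimension of the intersection changes by \<open>l - k\<close>; two exponents keep
  this difference within the natural numbers. The induction splits off one transposition at a time
  and applies it to \<open>D\<close>, which is therefore arbitrary.\<close>

lemma type_II_permutation_parity:
  assumes p: "p permutes {1..n}" and C: "type_II C" and D: "type_II D"
  shows "\<exists>k l. card (C \<inter> move p D) * 2 ^ k = card (C \<inter> D) * 2 ^ l \<and> (even (k + l) \<longleftrightarrow> evenperm p)"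
  using p finite_atLeastAtMost D
proof (induction arbitrary: D rule: permutes_induct)
  case id
  show ?case by (intro exI [of _ 0]) (simp add: evenperm_id)
next
  case (swap a b p)
  let ?t = "Transposition.transpose a b"
  have t: "?t permutes {1..n}" using swap by (simp add: permutes_swap_id)
  have "type_II (move ?t D)" using t swap.prems type_II_move by blast
  then obtain k l where kl: "card (C \<inter> move p (move ?t D)) * 2 ^ k = card (C \<inter> move ?t D) * 2 ^ l"
      "even (k + l) \<longleftrightarrow> evenperm p"
    using swap.IH by blast
  define q where "q = ?t \<circ> p"
  have eq: "move p (move ?t D) = move q D" by (auto simp: q_def image_image comp_assoc)
  have "permutation p"
    unfolding permutation_permutes using swap.hyps by (intro exI [of _ "{1..n}"] conjI) simp_all
  moreover have "permutation ?t" by (rule permutation_swap_id)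
  ultimately have parity: "evenperm q \<longleftrightarrow> \<not> evenperm p"
    using swap.hyps by (simp add: q_def evenperm_comp evenperm_swap)
  from type_II_transpose [OF C swap.prems swap.hyps(1,2,3)]
  have "\<exists>k l. card (C \<inter> move q D) * 2 ^ k = card (C \<inter> D) * 2 ^ l
      \<and> (even (k + l) \<longleftrightarrow> evenperm q)"
  proof
    assume "card (C \<inter> move ?t D) = 2 * card (C \<inter> D)"
    then show ?thesis
      using kl parity unfolding eq by (intro exI [of _ k] exI [of _ "Suc l"] conjI) simp_all
  next
    assume "card (C \<inter> D) = 2 * card (C \<inter> move ?t D)"
    then show ?thesis
      using kl parity unfolding eq by (intro exI [of _ "Suc k"] exI [of _ l] conjI) simp_all
  qed
  then show ?case unfolding q_def .
qed

text \<open>With both codes equal to \<open>C\<close> the intersection does not change, so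
  \<open>k = l\<close> and the parity is even.\<close>

lemma type_II_stabilizer_even:
  assumes p: "p permutes {1..n}" and C: "type_II C" and "move p C = C"
  shows "evenperm p"
proof -
  obtain k l where kl: "card C * 2 ^ k = card C * 2 ^ l" "even (k + l) \<longleftrightarrow> evenperm p"
    using type_II_permutation_parity [OF p C C] assms(3) by auto
  moreover have "card C \<noteq> 0" using C by (auto simp: type_II_def doubly_even_def lin_def)
  ultimately have "k = l" by simp
  then show ?thesis using kl(2) by simp
qed

text \<open>The words of \<open>D\<close> of weight divisible by four form a subcode \<open>K\<close> of index two. The sum of
  \<open>iota\<close> over \<open>D\<close> vanishes, so that by the Gauss sum over the dual of \<open>K\<close> the words of that dual
  outside \<open>D\<close> have weight divisible by four.\<close>

lemma type_II_if_self_dual: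
  assumes n: "8 dvd n" and D: "lin D" "perp D = D"
    and G: "\<And>p. p \<in> G \<Longrightarrow> p permutes {1..n} \<and> evenperm p \<and> move p D \<subseteq> D"
  obtains E where "type_II E" "\<And>p. p \<in> G \<Longrightarrow> move p E = E"
proof (cases "\<forall>d\<in>D. iota d = 1")
  case True
  moreover have "move p D = D" if "p \<in> G" for p
    using G [OF that] card_move [of p D] D(1) by (intro card_subset_eq) auto
  ultimately show ?thesis using that [of D] D by (auto simp: type_II_def doubly_even_def)
next
  case False
  define K where "K = {x \<in> D. iota x = 1}"
  have orth: "dot x y = 0" if "x \<in> D" "y \<in> D" for x y
    using that D(2) by (auto simp: perp_def)
  have iotaD: "iota x = 1 \<or> iota x = -1" if "x \<in> D" for x
  proof -
    have "iota x * iota x = 1" using iota_add [of x x] orth [OF that that] by simp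
    then show ?thesis by (metis square_eq_1_iff)
  qed
  have iota_addD: "iota (x + y) = iota x * iota y" if "x \<in> D" "y \<in> D" for x y
    by (simp add: iota_add orth that)
  have K: "lin K" using D(1) by (auto simp: lin_def K_def iota_addD)
  obtain u where u: "u \<in> D" "iota u = -1" using False iotaD by blast
  have uK: "u \<notin> K" using u by (auto simp: K_def)
  have coset: "x + u \<in> K" if "x \<in> D" "x \<notin> K" for x
    using that u iotaD [of x] D(1) by (auto simp: K_def iota_addD linD)
  \<comment> \<open>Otherwise dualizing would give \<open>D \<subseteq> K\<close>, against the
    choice of \<open>u\<close>.\<close>
  have "\<not> perp K \<subseteq> D"
    using perp_anti [of "perp K" D] D K u uK by auto
  then obtain w where w: "w \<in> perp K" "w \<notin> D" by blast
  have wK: "dot w x = 0" if "x \<in> K" for x using w that by (auto simp: perp_def)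
  have wu: "dot w u = 1"
  proof (rule ccontr)
    assume "dot w u \<noteq> 1"
    then have "dot w u = 0" by simp
    then have "dot w x = 0" if "x \<in> D" for x
      using wK coset [OF that] wK [of "x + u"] by (cases "x \<in> K") (auto simp: dot_add_right)
    then have "w \<in> perp D" using w by (auto simp: perp_def)
    then show False using w D by simp
  qed
  have dotw: "dot w x = (if x \<in> K then 0 else 1)" if "x \<in> D" for x
  proof (cases "x \<in> K")
    case False
    then have "dot w (x + u) = 0" using coset [OF that] wK by blast
    then show ?thesis using False wu by (cases "dot w x") (simp_all add: dot_add_right)
  qed (simp add: wK)
  \<comment> \<open>The coset of \<open>D\<close> that contains \<open>x\<close> is decided by
    \<open>dot x u\<close>, since \<open>dot w\<close> restricted to \<open>D\<close> is the
    functional with kernel \<open>K\<close>.\<close>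
  have perpK: "perp K = D \<union> (\<lambda>d. w + d) ` D"
  proof
    have "D \<subseteq> perp K" using perp_anti [of K D] D by (auto simp: K_def)
    then show "D \<union> (\<lambda>d. w + d) ` D \<subseteq> perp K" using w by (auto simp: linD(3) [OF lin_perp])
    show "perp K \<subseteq> D \<union> (\<lambda>d. w + d) ` D"
    proof
      fix x assume x: "x \<in> perp K"
      show "x \<in> D \<union> (\<lambda>d. w + d) ` D"
      proof (cases "dot x u = 0")
        case True
        have "dot x d = 0" if "d \<in> D" for d
        proof (cases "d \<in> K")
          case False
          then have "dot x (d + u) = 0" using coset [OF that] x by (auto simp: perp_def)
          then show ?thesis using True by (simp add: dot_add_right)
        qed (use x in \<open>auto simp: perp_def\<close>)
        then have "x \<in> perp D" using x by (auto simp: perp_def)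
        then show ?thesis using D by simp
      next
        case False
        have "dot (w + x) d = 0" if "d \<in> D" for d
        proof (cases "d \<in> K")
          case True
          then show ?thesis using x wK by (auto simp: perp_def dot_add_left)
        next
          case dK: False
          then have "dot x (d + u) = 0" using coset [OF that] x by (auto simp: perp_def)
          then have "dot x d = 1" using False by (cases "dot x d") (simp_all add: dot_add_right)
          then show ?thesis using dotw [OF that] dK by (simp add: dot_add_left)
        qed
        moreover have "w + x \<in> V" using x w by (auto simp: perp_def add_in_V)
        ultimately have "w + x \<in> perp D" by (auto simp: perp_def)
        then have "w + x \<in> D" "x = w + (w + x)" using D by simp_all
        then show ?thesis by blast
      qed
    qed
  qed
  have disj: "D \<inter> (\<lambda>d. w + d) ` D = {}"
    using w D(1) lin_add_cancel' [OF D(1)] by auto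
  have inj: "inj_on (\<lambda>d. w + d) D" by (rule inj_onI) simp
  have DK: "D = K \<union> (\<lambda>x. x + u) ` K"
  proof
    show "D \<subseteq> K \<union> (\<lambda>x. x + u) ` K"
    proof
      fix x assume "x \<in> D"
      then have "x \<in> K \<or> x + u \<in> K" "x = (x + u) + u" using coset by (auto simp: add.assoc)
      then show "x \<in> K \<union> (\<lambda>x. x + u) ` K" by blast
    qed
    show "K \<union> (\<lambda>x. x + u) ` K \<subseteq> D" using u D(1) by (auto simp: K_def linD)
  qed
  have disjK: "K \<inter> (\<lambda>x. x + u) ` K = {}"
    using uK lin_add_cancel [OF K] by auto
  have injK: "inj_on (\<lambda>x. x + u) K" by (rule inj_onI) simp
  have cardD: "card D = 2 * card K"
    by (subst DK) (simp add: card_Un_disjoint disjK K card_image injK)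
  have "(\<Sum>x\<in>D. iota x) = (\<Sum>x\<in>K. iota x) + (\<Sum>x\<in>K. iota (x + u))"
    by (subst DK) (simp add: sum.union_disjoint disjK K sum.reindex injK)
  also have "\<dots> = 0"
    using u by (simp add: K_def iota_addD)
  finally have sumD: "(\<Sum>x\<in>D. iota x) = 0" .
  \<comment> \<open>For \<open>d\<close> outside \<open>K\<close> the two signs
    \<open>iota d = -1\<close> and \<open>chi (dot w d) = -1\<close> cancel.\<close>
  have "iota (w + d) = iota w" if "d \<in> D" for d
    using iotaD [OF that] that by (auto simp: iota_add dotw K_def chi_def)
  then have "(\<Sum>x\<in>(\<lambda>d. w + d) ` D. iota x) = of_nat (card D) * iota w"
    by (simp add: sum.reindex inj)
  then have "(\<Sum>x\<in>perp K. iota x) = of_nat (card D) * iota w"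
    unfolding perpK using sumD D(1) disj by (simp add: sum.union_disjoint)
  moreover have "doubly_even K" using K by (auto simp: doubly_even_def K_def)
  ultimately have gauss: "of_nat (card D) * iota w = (1 + \<i>) ^ n"
    using sum_iota_perp by simp
  obtain m where m: "n = 8 * m" using n by blast
  \<comment> \<open>Divisibility of \<open>n\<close> by eight makes the Gauss sum equal to
    \<open>card D\<close>, hence \<open>iota w = 1\<close>.\<close>
  have "(1 + \<i>) ^ 8 = 2 ^ 4" by (simp add: eval_nat_numeral complex_eq_iff)
  then have "(1 + \<i>) ^ n = 2 ^ (4 * m)" unfolding m power_mult by simp
  moreover have "card D = 2 ^ (4 * m)"
  proof -
    have "card D ^ 2 = (2 ^ (4 * m)) ^ 2"
      using card_self_dual [OF D] unfolding m power_mult [symmetric] by (simp add: mult.commute)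
    then show ?thesis by (rule power2_eq_imp_eq) simp_all
  qed
  ultimately have iw: "iota w = 1" using gauss by simp
  have wKn: "w \<notin> K" using w by (auto simp: K_def)
  \<comment> \<open>One of the two Type II codes containing \<open>K\<close>; the other one uses the
    coset of \<open>u + w\<close>.\<close>
  define E where "E = K \<union> (\<lambda>x. x + w) ` K"
  have E: "lin E"
    unfolding lin_def
  proof (intro conjI ballI)
    have "w \<in> V" using w by (simp add: perp_def)
    then show "E \<subseteq> V" using linD(1) [OF K] add_in_V unfolding E_def by blast
    show "0 \<in> E" using K by (simp add: E_def linD)
    fix x y assume "x \<in> E" "y \<in> E"
    then have "(x \<in> K \<or> x + w \<in> K) \<and> (y \<in> K \<or> y + w \<in> K)" by (auto simp: E_def add.assoc)
    moreover have "x + y = (x + (y + w)) + w" "x + y = ((x + w) + y) + w" "x + y = (x + w) + (y + w)"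
      by (simp_all add: ac_simps)
    ultimately have "x + y \<in> K \<or> (x + y) + w \<in> K"
      using linD(3) [OF K] by (elim conjE disjE) (metis bit_fun_add_self_left add.commute)+
    moreover have "x + y = ((x + y) + w) + w" by (simp add: add.assoc)
    ultimately show "x + y \<in> E" unfolding E_def by blast
  qed
  have iotaE: "iota x = 1" if "x \<in> E" for x
    using that wK by (auto simp: E_def K_def iota_add iw dot_commute)
  have "card E = 2 * card K"
  proof -
    have "K \<inter> (\<lambda>x. x + w) ` K = {}" using wKn lin_add_cancel [OF K] by auto
    moreover have "inj_on (\<lambda>x. x + w) K" by (rule inj_onI) simp
    ultimately show ?thesis by (simp add: E_def card_Un_disjoint K card_image)
  qed
  then have cardE: "card E = card D" using cardD by simp
  have dE: "doubly_even E" using E iotaE by (simp add: doubly_even_def)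
  have II: "type_II E"
    unfolding type_II_def
    using dE self_dual_if_card [OF E doubly_even_self_orthogonal [OF dE]] cardE card_self_dual [OF D]
    by simp
  have "move p E = E" if "p \<in> G" for p
  proof (rule ccontr)
    assume ne: "move p E \<noteq> E"
    have p: "p permutes {1..n}" "evenperm p" "move p D \<subseteq> D" using G [OF that] by auto
    have "move p K \<subseteq> K" using p by (auto simp: K_def iota_comp)
    then have pK: "move p K = K"
      using card_move [OF p(1)] K by (intro card_subset_eq) auto
    have lpE: "lin (move p E)" using p E lin_move by blast
    \<comment> \<open>If \<open>p\<close> moves \<open>E\<close>, the intersection has index two in
      \<open>E\<close>. Then \<open>k = Suc l\<close> in \<open>type_II_permutation_parity\<close>,
      which is impossible for an even permutation.\<close>
    have "E \<inter> move p E = K"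
    proof
      have "K \<subseteq> move p E" using pK by (auto simp: E_def)
      then show "K \<subseteq> E \<inter> move p E" by (auto simp: E_def)
      show "E \<inter> move p E \<subseteq> K"
      proof
        fix x assume x: "x \<in> E \<inter> move p E"
        show "x \<in> K"
        proof (rule ccontr)
          assume "x \<notin> K"
          then obtain y where "y \<in> K" "x = y + w" using x unfolding E_def by blast
          then have "x + w \<in> K" by (simp add: add.assoc)
          then have "x + (x + w) \<in> move p E" using x lpE \<open>K \<subseteq> move p E\<close> linD(3) by blast
          then have "w \<in> move p E" by simp
          then have "E \<subseteq> move p E" using \<open>K \<subseteq> move p E\<close> lpE linD(3) by (auto simp: E_def)
          then have "E = move p E" using card_move [OF p(1)] lpE by (intro card_subset_eq) auto
          then show False using ne by simp
        qed
      qed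
    qed
    then obtain k l where kl: "card K * 2 ^ k = card E * 2 ^ l" "even (k + l)"
      using type_II_permutation_parity [OF p(1) II II] p(2) by auto
    moreover have "card K \<noteq> 0" using K by (auto simp: lin_def)
    ultimately have "(2 :: nat) ^ k = 2 ^ Suc l" using \<open>card E = 2 * card K\<close> by simp
    then have "k = Suc l" by (simp only: power_inject_exp [of 2] one_less_numeral_iff semiring_norm)
    then show False using kl(2) by simp
  qed
  then show ?thesis using that II by blast
qed

end

section \<open>Modules over the group algebra\<close>

context F2G_module
begin

lemma smult_cases: "x \<in> carrier M \<Longrightarrow> a \<odot>\<^bsub>M\<^esub> x = (if a = 0 then \<zero>\<^bsub>M\<^esub> else x)"
  using smult_l_null [of x] smult_one [of x] by (cases a) (simp_all add: F2_def)

lemma add_self: "x \<in> carrier M \<Longrightarrow> x \<oplus>\<^bsub>M\<^esub> x = \<zero>\<^bsub>M\<^esub>"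
  using smult_l_distr [of 1 1 x] smult_cases [of x 0] smult_cases [of x 1] by (simp add: F2_def)

lemma a_inv_self: "x \<in> carrier M \<Longrightarrow> \<ominus>\<^bsub>M\<^esub> x = x"
  using add_self M.minus_equality by blast

lemma add_eq_zero_iff:
  "x \<in> carrier M \<Longrightarrow> y \<in> carrier M \<Longrightarrow> x \<oplus>\<^bsub>M\<^esub> y = \<zero>\<^bsub>M\<^esub> \<longleftrightarrow> x = y"
  using add_self a_inv_self M.minus_equality by metis

text \<open>Every element is its own negative and the only scalars are 0 and 1, so closure under
  negation and scaling is automatic.\<close>

lemma submodule_iff:
  "submodule H F2 M \<longleftrightarrow> H \<subseteq> carrier M \<and> \<zero>\<^bsub>M\<^esub> \<in> H \<and> (\<forall>x\<in>H. \<forall>y\<in>H. x \<oplus>\<^bsub>M\<^esub> y \<in> H)"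
  (is "_ \<longleftrightarrow> ?R")
proof
  assume s: "submodule H F2 M"
  have "\<zero>\<^bsub>M\<^esub> \<in> H"
    using subgroup.one_closed [OF submodule.axioms(1) [OF s]] by simp
  then show ?R using submoduleE [OF s] by auto
next
  assume R: ?R
  show "submodule H F2 M"
  proof (rule submoduleI)
    show "\<ominus>\<^bsub>M\<^esub> a \<in> H" if "a \<in> H" for a using that R a_inv_self by auto
    show "a \<odot>\<^bsub>M\<^esub> x \<in> H" if "x \<in> H" for a x using that R smult_cases [of x a] by auto
  qed (use R in auto)
qed

lemma F2G_submodule_iff:
  "F2G_submodule G H M \<longleftrightarrow> H \<subseteq> carrier M \<and> \<zero>\<^bsub>M\<^esub> \<in> H \<and> (\<forall>x\<in>H. \<forall>y\<in>H. x \<oplus>\<^bsub>M\<^esub> y \<in> H)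
    \<and> (\<forall>x\<in>H. \<forall>g\<in>carrier G. act M x g \<in> H)"
  by (auto simp: F2G_submodule_def submodule_iff)

end

lemma cring_F2: "cring F2"
proof (rule cringI)
  show "abelian_group F2"
  proof (rule abelian_groupI)
    show "\<exists>y\<in>carrier F2. y \<oplus>\<^bsub>F2\<^esub> x = \<zero>\<^bsub>F2\<^esub>" for x
      by (rule bexI [of _ x]; cases x) (simp_all add: F2_def)
  qed (simp_all add: F2_def ac_simps)
  show "comm_monoid F2"
    by (rule comm_monoidI) (auto simp: F2_def ac_simps)
qed (simp add: F2_def distrib_right)

text \<open>The condition \<open>self\<close> supplies additive inverses, and the case distinction
  in \<open>smult\<close> yields all axioms about scalars.\<close>

lemma F2G_moduleI:
  fixes M :: "('m, 'g, 'd) gmodule_scheme" (structure)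
  assumes "group G"
    and add_closed: "\<And>x y. x \<in> carrier M \<Longrightarrow> y \<in> carrier M \<Longrightarrow> x \<oplus> y \<in> carrier M"
    and zero_closed: "\<zero> \<in> carrier M"
    and assoc: "\<And>x y z. x \<in> carrier M \<Longrightarrow> y \<in> carrier M \<Longrightarrow> z \<in> carrier M
      \<Longrightarrow> (x \<oplus> y) \<oplus> z = x \<oplus> (y \<oplus> z)"
    and comm: "\<And>x y. x \<in> carrier M \<Longrightarrow> y \<in> carrier M \<Longrightarrow> x \<oplus> y = y \<oplus> x"
    and zero: "\<And>x. x \<in> carrier M \<Longrightarrow> \<zero> \<oplus> x = x"
    and self: "\<And>x. x \<in> carrier M \<Longrightarrow> x \<oplus> x = \<zero>"
    and smult: "\<And>a x. x \<in> carrier M \<Longrightarrow> a \<odot> x = (if a = 0 then \<zero> else x)"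
    and act_closed: "\<And>x g. x \<in> carrier M \<Longrightarrow> g \<in> carrier G \<Longrightarrow> act M x g \<in> carrier M"
    and act_add: "\<And>x y g. x \<in> carrier M \<Longrightarrow> y \<in> carrier M \<Longrightarrow> g \<in> carrier G
      \<Longrightarrow> act M (x \<oplus> y) g = act M x g \<oplus> act M y g"
    and act_one: "\<And>x. x \<in> carrier M \<Longrightarrow> act M x \<one>\<^bsub>G\<^esub> = x"
    and act_mult: "\<And>x g h. x \<in> carrier M \<Longrightarrow> g \<in> carrier G \<Longrightarrow> h \<in> carrier G
      \<Longrightarrow> act M x (g \<otimes>\<^bsub>G\<^esub> h) = act M (act M x g) h"
  shows "F2G_module G M"
proof -
  have ag: "abelian_group M"
  proof (rule abelian_groupI)
    show "\<exists>y\<in>carrier M. y \<oplus> x = \<zero>" if "x \<in> carrier M" for x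
      using self that by blast
  qed (use assms in auto)
  have *: "act M \<zero> g = \<zero>" if "g \<in> carrier G" for g
    using act_add [OF zero_closed zero_closed that] self [OF zero_closed]
      self [OF act_closed [OF zero_closed that]] by simp
  have "Module.module F2 M"
  proof (rule Module.moduleI [OF cring_F2 ag])
    fix a b x assume "x \<in> carrier M"
    then show "(a \<oplus>\<^bsub>F2\<^esub> b) \<odot> x = a \<odot> x \<oplus> b \<odot> x"
      using zero [of x] comm [of x \<zero>] zero_closed self [of x] self [of \<zero>]
      by (cases a; cases b) (simp_all add: smult F2_def)
  next
    fix a b x assume "x \<in> carrier M"
    then show "(a \<otimes>\<^bsub>F2\<^esub> b) \<odot> x = a \<odot> (b \<odot> x)"
      using zero_closed by (cases a; cases b) (simp_all add: smult F2_def)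
  qed (use zero_closed add_closed self in \<open>auto simp: smult F2_def\<close>)
  then show ?thesis
    using assms(1) by (intro F2G_module.intro F2G_module_axioms.intro)
      (use assms * in \<open>auto simp: smult\<close>)
qed

section \<open>The permutation module of a subgroup of the symmetric group\<close>

locale perm_action = coordinates +
  fixes G :: "(nat \<Rightarrow> nat) set"
  assumes subgroup_G: "subgroup G (sym_group n)"
begin

abbreviation Gr :: "(nat \<Rightarrow> nat) monoid" where
  "Gr \<equiv> (sym_group n)\<lparr>carrier := G\<rparr>"

lemma group_Gr: "group Gr"
  using subgroup.subgroup_is_group [OF subgroup_G sym_group_is_group] .

lemma Gr_simps [simp]:
  "carrier Gr = G" "monoid.mult (sym_group n) = (\<circ>)" "\<one>\<^bsub>sym_group n\<^esub> = id"
  by (simp_all add: sym_group_mult sym_group_one)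

lemma G_permutes: "p \<in> G \<Longrightarrow> p permutes {1..n}"
  using subgroup.subset [OF subgroup_G] by (auto simp: sym_group_carrier)

lemma id_in_G: "id \<in> G" and comp_in_G: "p \<in> G \<Longrightarrow> q \<in> G \<Longrightarrow> p \<circ> q \<in> G"
  using subgroup.one_closed [OF subgroup_G] subgroup.m_closed [OF subgroup_G, of p q] by simp_all

lemma comp_in_V_G: "p \<in> G \<Longrightarrow> x \<in> V \<Longrightarrow> x \<circ> p \<in> V"
  by (rule comp_in_V [OF G_permutes])

lemma comp_comp_inv_G [simp]:
  "p \<in> G \<Longrightarrow> x \<circ> p \<circ> inv' p = x" "p \<in> G \<Longrightarrow> x \<circ> inv' p \<circ> p = x"
  by (rule comp_comp_inv [OF G_permutes], assumption)+

lemma inv_Gr: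
  assumes "p \<in> G"
  shows "inv\<^bsub>Gr\<^esub> p \<in> G" "inv\<^bsub>Gr\<^esub> p = inv' p"
proof -
  show *: "inv\<^bsub>Gr\<^esub> p \<in> G" using group.inv_closed [OF group_Gr, of p] assms by simp
  have "inv\<^bsub>Gr\<^esub> p \<circ> p = id" using group.l_inv [OF group_Gr, of p] assms by simp
  moreover have "p \<circ> inv' p = id" using permutes_inv_o [OF G_permutes [OF assms]] by simp
  ultimately show "inv\<^bsub>Gr\<^esub> p = inv' p" by (metis comp_assoc comp_id id_comp)
qed

lemma inv_in_G: "p \<in> G \<Longrightarrow> inv' p \<in> G"
  using inv_Gr by metis

definition submod :: "(nat \<Rightarrow> bit) set \<Rightarrow> bool" where
  "submod H \<longleftrightarrow> lin H \<and> (\<forall>x\<in>H. \<forall>p\<in>G. x \<circ> p \<in> H)"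

lemma submod_lin [simp]: "submod H \<Longrightarrow> lin H"
  by (simp add: submod_def)

lemma submod_comp: "submod H \<Longrightarrow> x \<in> H \<Longrightarrow> p \<in> G \<Longrightarrow> x \<circ> p \<in> H"
  by (simp add: submod_def)

lemma submod_V: "submod V"
  by (simp add: submod_def lin_V comp_in_V_G)

lemma submod_zero: "submod {0}"
  by (simp add: submod_def lin_zero)

lemma submod_Int: "submod A \<Longrightarrow> submod B \<Longrightarrow> submod (A \<inter> B)"
  by (auto simp: submod_def lin_Int)

lemma submod_plus: "submod A \<Longrightarrow> submod B \<Longrightarrow> submod (A + B)"
  unfolding submod_def by (auto simp: lin_plus comp_add elim!: set_plus_elim intro!: set_plus_intro)

lemma dot_comp_inv: "p \<in> G \<Longrightarrow> dot (x \<circ> p) y = dot x (y \<circ> inv' p)"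
  using dot_comp [OF G_permutes, of p x "y \<circ> inv' p"] by simp

lemma submod_perp: "submod A \<Longrightarrow> submod (perp A)"
  unfolding submod_def
proof (intro conjI ballI)
  fix x p assume "lin A \<and> (\<forall>x\<in>A. \<forall>p\<in>G. x \<circ> p \<in> A)" "x \<in> perp A" "p \<in> G"
  then show "x \<circ> p \<in> perp A"
    by (auto simp: perp_def dot_comp_inv inv_in_G comp_in_V_G)
qed simp

lemma F2G_module_perm: "F2G_module Gr (perm_module n)"
proof (rule F2G_moduleI [OF group_Gr])
  fix x g assume "x \<in> V" "g \<in> carrier Gr"
  then show "act (perm_module n) x g \<in> V"
    using comp_in_V_G by (simp add: perm_module_def)
qed (auto simp: perm_module_def fun_eq_iff ac_simps)

lemma perm_module_simps:
  "\<zero>\<^bsub>perm_module n\<^esub> = 0" "x \<oplus>\<^bsub>perm_module n\<^esub> y = x + y" "act (perm_module n) x p = x \<circ> p"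
  by (simp_all add: perm_module_def fun_eq_iff)

lemma linear_code_iff: "linear_code n C \<longleftrightarrow> lin C"
  unfolding linear_code_def F2G_module.submodule_iff [OF F2G_module_perm] lin_def perm_module_simps ..

lemma F2G_submodule_perm: "F2G_submodule Gr H (perm_module n) \<longleftrightarrow> submod H"
  unfolding F2G_module.F2G_submodule_iff [OF F2G_module_perm] submod_def lin_def perm_module_simps
  by auto

subsection \<open>Subquotients of the permutation module\<close>

text \<open>A factor map identifies the subquotient \<open>B/A\<close> of the permutation module with \<open>S\<close>.\<close>

definition factor_map ::
  "('s, nat \<Rightarrow> nat, 'd) gmodule_scheme \<Rightarrow> (nat \<Rightarrow> bit) set \<Rightarrow> (nat \<Rightarrow> bit) set
    \<Rightarrow> ((nat \<Rightarrow> bit) \<Rightarrow> 's) \<Rightarrow> bool" where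
  "factor_map S A B f \<longleftrightarrow> f ` B = carrier S \<and> (\<forall>x\<in>B. \<forall>y\<in>B. f (x + y) = f x \<oplus>\<^bsub>S\<^esub> f y)
    \<and> (\<forall>x\<in>B. \<forall>p\<in>G. f (x \<circ> p) = act S (f x) p) \<and> (\<forall>x\<in>B. f x = \<zero>\<^bsub>S\<^esub> \<longleftrightarrow> x \<in> A)"

text \<open>Stands for an isomorphism between \<open>S\<close> and \<open>B/A\<close>. Cosets then
  appear only where \<open>quot_module\<close> itself is treated.\<close>

definition factor_iso ::
  "('s, nat \<Rightarrow> nat, 'd) gmodule_scheme \<Rightarrow> (nat \<Rightarrow> bit) set \<Rightarrow> (nat \<Rightarrow> bit) set \<Rightarrow> bool" where
  "factor_iso S A B \<longleftrightarrow> (\<exists>f. factor_map S A B f)"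

text \<open>The covering relation in the lattice of submodules, that is, \<open>B/A\<close> is
  simple.\<close>

definition cover :: "(nat \<Rightarrow> bit) set \<Rightarrow> (nat \<Rightarrow> bit) set \<Rightarrow> bool" where
  "cover A B \<longleftrightarrow> submod A \<and> submod B \<and> A \<subset> B
    \<and> (\<forall>H. submod H \<longrightarrow> A \<subseteq> H \<longrightarrow> H \<subseteq> B \<longrightarrow> H = A \<or> H = B)"

lemma factor_mapD:
  assumes "factor_map S A B f"
  shows "f ` B = carrier S" "\<And>x. x \<in> B \<Longrightarrow> f x \<in> carrier S"
    "\<And>x y. x \<in> B \<Longrightarrow> y \<in> B \<Longrightarrow> f (x + y) = f x \<oplus>\<^bsub>S\<^esub> f y"
    "\<And>x p. x \<in> B \<Longrightarrow> p \<in> G \<Longrightarrow> f (x \<circ> p) = act S (f x) p"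
    "\<And>x. x \<in> B \<Longrightarrow> f x = \<zero>\<^bsub>S\<^esub> \<longleftrightarrow> x \<in> A"
  using assms unfolding factor_map_def by blast+

lemma factor_map_eq_iff:
  assumes "F2G_module Gr S" "factor_map S A B f" "lin B" "x \<in> B" "y \<in> B"
  shows "f x = f y \<longleftrightarrow> x + y \<in> A"
  using F2G_module.add_eq_zero_iff [OF assms(1), of "f x" "f y"] factor_mapD [OF assms(2)] assms(3-5)
    linD(3) [OF assms(3)] by metis

lemma factor_map_inv_into:
  assumes "factor_map S A B f" "s \<in> carrier S"
  shows "inv_into B f s \<in> B" "f (inv_into B f s) = s"
  using assms(2) factor_mapD(1) [OF assms(1)] inv_into_into [of s f B] f_inv_into_f [of s f B] by auto

text \<open>Both maps have kernel \<open>A\<close>, so applying \<open>g\<close> to any preimage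
  under \<open>f\<close> is well defined and bijective.\<close>

lemma F2G_iso_if_factor_maps:
  assumes S: "F2G_module Gr S" and T: "F2G_module Gr T"
    and f: "factor_map S A B f" and g: "factor_map T A B g" and B: "submod B"
  shows "F2G_iso Gr S T"
proof -
  interpret S: F2G_module Gr S by (rule S)
  interpret T: F2G_module Gr T by (rule T)
  note fD = factor_mapD [OF f] and gD = factor_mapD [OF g] and iD = factor_map_inv_into [OF f]
  note eqf = factor_map_eq_iff [OF S f submod_lin [OF B]]
  note eqg = factor_map_eq_iff [OF T g submod_lin [OF B]]
  define \<phi> where "\<phi> s = g (inv_into B f s)" for s
  have \<phi>: "\<phi> (f x) = g x" if "x \<in> B" for x
    unfolding \<phi>_def using eqf eqg iD fD(2) that by metis
  have rep: "\<exists>x\<in>B. s = f x" if "s \<in> carrier S" for s using that fD(1) by auto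
  have "bij_betw \<phi> (carrier S) (carrier T)"
    unfolding bij_betw_def
  proof
    show "inj_on \<phi> (carrier S)"
      by (rule inj_onI) (use rep \<phi> eqf eqg in metis)
    show "\<phi> ` carrier S = carrier T"
      using \<phi> by (simp flip: fD(1) gD(1) add: image_image)
  qed
  moreover have \<phi>_add: "\<phi> (x \<oplus>\<^bsub>S\<^esub> y) = \<phi> x \<oplus>\<^bsub>T\<^esub> \<phi> y" if "x \<in> carrier S" "y \<in> carrier S" for x y
    using rep [OF that(1)] rep [OF that(2)] linD(3) [OF submod_lin [OF B]]
    by (auto simp: \<phi> gD simp flip: fD(3))
  moreover have "\<phi> (a \<odot>\<^bsub>S\<^esub> x) = a \<odot>\<^bsub>T\<^esub> \<phi> x" if "x \<in> carrier S" for a x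
  proof -
    have "\<phi> x \<in> carrier T" using that rep \<phi> gD by auto
    moreover have "\<phi> \<zero>\<^bsub>S\<^esub> = \<zero>\<^bsub>T\<^esub>"
      using \<phi>_add [OF that that] S.add_self [OF that] T.add_self [OF calculation] by simp
    ultimately show ?thesis using that by (simp add: S.smult_cases T.smult_cases)
  qed
  moreover have "\<phi> (act S x p) = act T (\<phi> x) p" if "x \<in> carrier S" "p \<in> G" for x p
    using rep [OF that(1)] submod_comp [OF B] that(2) by (auto simp: \<phi> gD simp flip: fD(4))
  ultimately show ?thesis unfolding F2G_iso_def by (intro exI [of _ \<phi>]) auto
qed

lemma F2G_iso_zero:
  assumes "F2G_module Gr S" "F2G_module Gr T"
    and \<phi>: "\<phi> ` carrier S = carrier T" "\<And>x y. x \<in> carrier S \<Longrightarrow> y \<in> carrier S \<Longrightarrow> \<phi> (x \<oplus>\<^bsub>S\<^esub> y) = \<phi> x \<oplus>\<^bsub>T\<^esub> \<phi> y"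
  shows "\<phi> \<zero>\<^bsub>S\<^esub> = \<zero>\<^bsub>T\<^esub>"
proof -
  interpret S: F2G_module Gr S by fact
  interpret T: F2G_module Gr T by fact
  show ?thesis using \<phi> T.add_self S.add_self by (metis S.M.zero_closed imageI)
qed

text \<open>The factor map onto \<open>T\<close> is followed by the inverse of the isomorphism from
  \<open>S\<close> to \<open>T\<close>.\<close>

lemma factor_iso_F2G_iso:
  assumes S: "F2G_module Gr S" and T: "F2G_module Gr T" and iso: "F2G_iso Gr S T"
    and f: "factor_map T A B f" and B: "submod B"
  shows "factor_iso S A B"
proof -
  interpret S: F2G_module Gr S by (rule S)
  obtain \<phi> where \<phi>: "bij_betw \<phi> (carrier S) (carrier T)"
    "\<And>x y. x \<in> carrier S \<Longrightarrow> y \<in> carrier S \<Longrightarrow> \<phi> (x \<oplus>\<^bsub>S\<^esub> y) = \<phi> x \<oplus>\<^bsub>T\<^esub> \<phi> y"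
    "\<And>x p. x \<in> carrier S \<Longrightarrow> p \<in> G \<Longrightarrow> \<phi> (act S x p) = act T (\<phi> x) p"
    using iso by (auto simp: F2G_iso_def)
  have \<phi>0: "\<phi> \<zero>\<^bsub>S\<^esub> = \<zero>\<^bsub>T\<^esub>"
    using F2G_iso_zero [OF S T _ \<phi>(2)] \<phi>(1) by (simp add: bij_betw_def)
  define g where "g x = inv_into (carrier S) \<phi> (f x)" for x
  have inj: "inj_on \<phi> (carrier S)" using \<phi>(1) by (simp add: bij_betw_def)
  have g: "g x \<in> carrier S" "\<phi> (g x) = f x" if "x \<in> B" for x
  proof -
    have "f x \<in> \<phi> ` carrier S" using \<phi>(1) factor_mapD(2) [OF f that] by (simp add: bij_betw_def)
    then show "g x \<in> carrier S" "\<phi> (g x) = f x"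
      by (auto simp: g_def intro: inv_into_into f_inv_into_f)
  qed
  have gI: "g x = s" if "x \<in> B" "s \<in> carrier S" "\<phi> s = f x" for x s
    using inj_onD [OF inj, of "g x" s] g [OF that(1)] that by simp
  have "g ` B = carrier S"
  proof
    show "g ` B \<subseteq> carrier S" using g by auto
    show "carrier S \<subseteq> g ` B"
    proof
      fix s assume s: "s \<in> carrier S"
      then have "\<phi> s \<in> f ` B" using \<phi>(1) factor_mapD(1) [OF f] by (auto simp: bij_betw_def)
      then show "s \<in> g ` B" using gI s by force
    qed
  qed
  moreover have "g (x + y) = g x \<oplus>\<^bsub>S\<^esub> g y" if "x \<in> B" "y \<in> B" for x y
    using that B g \<phi>(2) factor_mapD(3) [OF f] by (intro gI) (auto simp: linD)
  moreover have "g (x \<circ> p) = act S (g x) p" if "x \<in> B" "p \<in> G" for x p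
    using that B g \<phi>(3) factor_mapD(4) [OF f] S.act_closed by (intro gI) (auto simp: submod_comp)
  moreover have "g x = \<zero>\<^bsub>S\<^esub> \<longleftrightarrow> x \<in> A" if "x \<in> B" for x
    using g [OF that] factor_mapD(5) [OF f that] \<phi>0 gI [OF that S.M.zero_closed] by metis
  ultimately have "factor_map S A B g" by (simp add: factor_map_def)
  then show ?thesis unfolding factor_iso_def by blast
qed

text \<open>Correspondence theorem: images and preimages under \<open>f\<close> match the submodules
  of \<open>S\<close> with those between \<open>A\<close> and \<open>B\<close>.\<close>

lemma simple_iff_cover:
  assumes S: "F2G_module Gr S" and f: "factor_map S A B f" and A: "submod A" and B: "submod B"
    and AB: "A \<subseteq> B"
  shows "simple_F2G_module Gr S \<longleftrightarrow> cover A B"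
proof -
  interpret S: F2G_module Gr S by (rule S)
  note fD = factor_mapD [OF f]
  note eqf = factor_map_eq_iff [OF S f submod_lin [OF B]]
  have neq: "carrier S \<noteq> {\<zero>\<^bsub>S\<^esub>} \<longleftrightarrow> A \<noteq> B"
  proof
    assume "carrier S \<noteq> {\<zero>\<^bsub>S\<^esub>}"
    then show "A \<noteq> B" using fD(1,5) S.M.zero_closed by auto
  next
    assume "A \<noteq> B"
    then show "carrier S \<noteq> {\<zero>\<^bsub>S\<^esub>}" using fD(2,5) AB by auto
  qed
  show ?thesis
  proof
    assume simple: "simple_F2G_module Gr S"
    have "H = A \<or> H = B" if H: "submod H" "A \<subseteq> H" "H \<subseteq> B" for H
    proof -
      have "F2G_submodule Gr (f ` H) S"
        unfolding S.F2G_submodule_iff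
      proof (intro conjI ballI)
        show "f ` H \<subseteq> carrier S" using H fD(2) by auto
        show "\<zero>\<^bsub>S\<^esub> \<in> f ` H" using H fD(5) [of 0] linD(2) [OF submod_lin] A by (metis imageI subsetD)
        fix x assume "x \<in> f ` H"
        then obtain x' where x: "x' \<in> H" "x = f x'" by blast
        show "x \<oplus>\<^bsub>S\<^esub> y \<in> f ` H" if "y \<in> f ` H" for y
          using x that H by (auto simp: linD subset_eq simp flip: fD(3))
        show "act S x g \<in> f ` H" if "g \<in> carrier Gr" for g
          using x that H by (auto simp: submod_comp subset_eq simp flip: fD(4))
      qed
      then consider "f ` H = {\<zero>\<^bsub>S\<^esub>}" | "f ` H = carrier S"
        using simple by (auto simp: simple_F2G_module_def)
      then show ?thesis
      proof cases
        case 1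
        then show ?thesis using fD(5) H by auto
      next
        case 2
        have "x \<in> H" if "x \<in> B" for x
        proof -
          have "f x \<in> f ` H" using 2 fD(2) [OF that] by simp
          then obtain h where h: "h \<in> H" "f x = f h" by blast
          then have "x + h \<in> H" using eqf that H by blast
          then show ?thesis using h lin_add_cancel' [OF submod_lin [OF H(1)]] by blast
        qed
        then show ?thesis using H by auto
      qed
    qed
    moreover have "A \<noteq> B" using simple neq by (simp add: simple_F2G_module_def)
    ultimately show "cover A B" using A B AB by (auto simp: cover_def)
  next
    assume cover: "cover A B"
    have "K = {\<zero>\<^bsub>S\<^esub>} \<or> K = carrier S" if "F2G_submodule Gr K S" for K
    proof -
      have K: "K \<subseteq> carrier S" "\<zero>\<^bsub>S\<^esub> \<in> K" "\<And>x y. x \<in> K \<Longrightarrow> y \<in> K \<Longrightarrow> x \<oplus>\<^bsub>S\<^esub> y \<in> K"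
        "\<And>x p. x \<in> K \<Longrightarrow> p \<in> G \<Longrightarrow> act S x p \<in> K"
        using that unfolding S.F2G_submodule_iff by auto
      define H where "H = {x \<in> B. f x \<in> K}"
      have fH: "f ` H = K" using K(1) fD(1) by (auto simp: H_def)
      have fA: "f x \<in> K" if "x \<in> A" for x using fD(5) [of x] K(2) AB that by (metis subsetD)
      moreover have "0 \<in> A" using A linD(2) submod_lin by blast
      ultimately have "f 0 \<in> K" by blast
      then have "submod H" using B K fD by (auto simp: submod_def lin_def H_def subset_eq)
      moreover have "A \<subseteq> H" using AB fA by (auto simp: H_def)
      moreover have "H \<subseteq> B" by (auto simp: H_def)
      ultimately consider "H = A" | "H = B" using cover by (auto simp: cover_def)
      then show ?thesis
      proof cases
        case 1
        then show ?thesis using fH fD(5) K(2) AB by auto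
      next
        case 2
        then show ?thesis using fH fD(1) by simp
      qed
    qed
    then show "simple_F2G_module Gr S"
      using S neq cover by (auto simp: simple_F2G_module_def cover_def)
  qed
qed

abbreviation subquotient :: "(nat \<Rightarrow> bit) set \<Rightarrow> (nat \<Rightarrow> bit) set \<Rightarrow> ((nat \<Rightarrow> bit) set, nat \<Rightarrow> nat) gmodule" where
  "subquotient A B \<equiv> quot_module ((perm_module n)\<lparr>carrier := B\<rparr>) A"

text \<open>Cosets are written as \<open>c x\<close>, and their equality is reduced to
  \<open>x + y \<in> A\<close>. All operations of \<open>quot_module\<close> then become operations
  on representatives.\<close>

lemma subquotient:
  assumes A: "submod A" and B: "submod B" and AB: "A \<subseteq> B"
  shows "F2G_module Gr (subquotient A B)" (is ?M)
    and "factor_map (subquotient A B) A B (\<lambda>x. (\<lambda>a. a + x) ` A)" (is ?F)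
proof -
  let ?Q = "subquotient A B"
  define c where "c x = (\<lambda>a. a + x) ` A" for x
  have A0: "0 \<in> A" using A by (simp add: linD)
  have cx: "x \<in> c x" for x using A0 by (force simp: c_def)
  have mem_c: "y \<in> c x \<longleftrightarrow> x + y \<in> A" for x y
  proof
    assume "x + y \<in> A"
    moreover have "y = (x + y) + x" by (simp add: ac_simps)
    ultimately show "y \<in> c x" unfolding c_def by blast
  next
    assume "y \<in> c x"
    then show "x + y \<in> A" by (auto simp: c_def ac_simps)
  qed
  have c_eq: "c x = c y \<longleftrightarrow> x + y \<in> A" for x y
  proof
    assume "c x = c y"
    then show "x + y \<in> A" using cx [of y] mem_c [of y x] by simp
  next
    assume xy: "x + y \<in> A"
    have "x + z \<in> A \<longleftrightarrow> y + z \<in> A" for z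
    proof -
      have "x + z = (x + y) + (y + z)" by (simp add: add.assoc)
      then show ?thesis using lin_add_cancel [OF submod_lin [OF A] xy] by metis
    qed
    then show "c x = c y" using mem_c by blast
  qed
  have cA: "c 0 = A" by (simp add: c_def)
  have carr: "carrier ?Q = c ` B"
    by (auto simp: quot_module_def A_RCOSETS_def' a_r_coset_def' perm_module_simps c_def image_def)
  have zero: "\<zero>\<^bsub>?Q\<^esub> = c 0" by (simp add: quot_module_def cA)
  have set_add: "X <+>\<^bsub>(perm_module n)\<lparr>carrier := B\<rparr>\<^esub> Y = {x + y | x y. x \<in> X \<and> y \<in> Y}" for X Y
    by (auto simp: set_add_def' perm_module_def plus_fun_def)
  have c_add: "{u + v | u v. u \<in> c x \<and> v \<in> c y} = c (x + y)" for x y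
  proof
    show "{u + v | u v. u \<in> c x \<and> v \<in> c y} \<subseteq> c (x + y)"
    proof clarify
      fix u v assume "u \<in> c x" "v \<in> c y"
      then have "(x + u) + (y + v) \<in> A" using A by (simp add: mem_c linD)
      then show "u + v \<in> c (x + y)" by (simp add: mem_c ac_simps)
    qed
    show "c (x + y) \<subseteq> {u + v | u v. u \<in> c x \<and> v \<in> c y}"
    proof
      fix z assume "z \<in> c (x + y)"
      then have "z + y \<in> c x" by (simp add: mem_c ac_simps)
      moreover have "z = (z + y) + y" by (simp add: add.assoc)
      ultimately show "z \<in> {u + v | u v. u \<in> c x \<and> v \<in> c y}" using cx [of y] by blast
    qed
  qed
  have add: "c x \<oplus>\<^bsub>?Q\<^esub> c y = c (x + y)" for x y
    using c_add by (simp add: quot_module_def set_add)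
  have smult: "a \<odot>\<^bsub>?Q\<^esub> c x = (if a = 0 then c 0 else c x)" for a x
  proof (cases "a = 0")
    case True
    have "(\<lambda>u. 0 \<odot>\<^bsub>(perm_module n)\<lparr>carrier := B\<rparr>\<^esub> u) ` c x = {0}"
      using cx [of x] by (auto simp: perm_module_def fun_eq_iff)
    then show ?thesis using True by (auto simp: quot_module_def set_add cA)
  next
    case False
    have "(\<lambda>u. 1 \<odot>\<^bsub>(perm_module n)\<lparr>carrier := B\<rparr>\<^esub> u) ` c x = c x"
      by (auto simp: perm_module_def)
    then show ?thesis using False c_add [of 0 x] by (simp add: quot_module_def set_add cA)
  qed
  have act: "act ?Q (c x) p = c (x \<circ> p)" if "p \<in> G" for x p
  proof -
    have "move p (c x) = c (x \<circ> p)"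
    proof
      show "move p (c x) \<subseteq> c (x \<circ> p)"
        using submod_comp [OF A _ that] by (auto simp: mem_c simp flip: comp_add)
      show "c (x \<circ> p) \<subseteq> move p (c x)"
      proof
        fix y assume "y \<in> c (x \<circ> p)"
        then have "((x \<circ> p) + y) \<circ> inv' p \<in> A" using submod_comp [OF A _ inv_in_G [OF that]] by (simp add: mem_c)
        then have "y \<circ> inv' p \<in> c x" using that by (simp add: comp_add mem_c)
        moreover have "y = (y \<circ> inv' p) \<circ> p" using that by simp
        ultimately show "y \<in> move p (c x)" by blast
      qed
    qed
    then show ?thesis by (simp add: quot_module_def perm_module_def)
  qed
  have B': "\<And>x y. x \<in> B \<Longrightarrow> y \<in> B \<Longrightarrow> x + y \<in> B" "0 \<in> B" using B by (auto simp: linD)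
  show ?M
  proof (rule F2G_moduleI [OF group_Gr])
    show "\<zero>\<^bsub>?Q\<^esub> \<in> carrier ?Q" using B' by (auto simp: carr zero)
    show "a \<odot>\<^bsub>?Q\<^esub> x = (if a = 0 then \<zero>\<^bsub>?Q\<^esub> else x)" if "x \<in> carrier ?Q" for a x
      using that by (auto simp: carr smult zero)
  qed (auto simp: carr zero add act B' ac_simps submod_comp [OF B] comp_add comp_assoc
      id_in_G comp_in_G
      intro!: imageI arg_cong [of _ _ c])
  show ?F
    unfolding factor_map_def c_def [symmetric]
    using c_eq [of _ 0] by (auto simp: carr add act zero)
qed

lemma F2G_iso_subquotient_iff:
  assumes "F2G_module Gr S" "submod A" "submod B" "A \<subseteq> B"
  shows "F2G_iso Gr S (subquotient A B) \<longleftrightarrow> factor_iso S A B"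
  using factor_iso_F2G_iso F2G_iso_if_factor_maps subquotient assms unfolding factor_iso_def by metis

lemma simple_subquotient_iff:
  assumes "submod A" "submod B" "A \<subseteq> B"
  shows "simple_F2G_module Gr (subquotient A B) \<longleftrightarrow> cover A B"
  using simple_iff_cover subquotient assms by blast

text \<open>In one direction each \<open>x \<in> B + A'\<close> is replaced by some
  \<open>r x \<in> B\<close> congruent to it modulo \<open>A'\<close>; the value
  \<open>f (r x)\<close> is independent of this choice because \<open>f\<close> vanishes on
  \<open>B \<inter> A'\<close>. In the other direction \<open>f\<close> is restricted to
  \<open>B\<close>.\<close>

lemma factor_iso_second_isomorphism:
  assumes S: "F2G_module Gr S" and sub: "submod A'" "submod B"
    and A: "A = B \<inter> A'" and B': "B' = B + A'"
  shows "factor_iso S A B \<longleftrightarrow> factor_iso S A' B'"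
proof
  assume "factor_iso S A B"
  then obtain f where f: "factor_map S A B f" by (auto simp: factor_iso_def)
  note fD = factor_mapD [OF f]
  define r where "r x = (SOME b. b \<in> B \<and> x + b \<in> A')" for x
  have r: "r x \<in> B \<and> x + r x \<in> A'" if x: "x \<in> B'" for x
  proof -
    obtain b a where "b \<in> B" "a \<in> A'" "x = b + a" using x B' by (auto elim!: set_plus_elim)
    then have "\<exists>b. b \<in> B \<and> x + b \<in> A'" by (intro exI [of _ b]) (simp add: ac_simps)
    then show ?thesis unfolding r_def by (rule someI_ex)
  qed
  have f'I: "f (r x) = f b" if "x \<in> B'" "b \<in> B" "x + b \<in> A'" for x b
  proof -
    have "r x + b = (x + r x) + (x + b)" by (simp add: ac_simps)
    then have "r x + b \<in> A" using r [OF that(1)] that sub A by (metis IntI linD(3) submod_lin)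
    then show ?thesis using factor_map_eq_iff [OF S f] r that sub by auto
  qed
  have BB': "B \<subseteq> B'" using subset_plus1 sub B' by auto
  have "factor_map S A' B' (\<lambda>x. f (r x))"
    unfolding factor_map_def
  proof (intro conjI ballI)
    have "f (r b) = f b" if "b \<in> B" for b
    proof (rule f'I [OF _ that])
      show "b \<in> B'" using that BB' by blast
      show "b + b \<in> A'" using sub linD(2) by simp
    qed
    then show "(\<lambda>x. f (r x)) ` B' = carrier S"
      unfolding fD(1) [symmetric] using r BB' by (auto simp: image_iff) (metis subsetD)
    fix x assume x: "x \<in> B'"
    show "f (r (x + y)) = f (r x) \<oplus>\<^bsub>S\<^esub> f (r y)" if y: "y \<in> B'" for y
    proof -
      have "lin B'" using sub B' lin_plus by simp
      have "(x + r x) + (y + r y) \<in> A'" using x y r sub by (simp add: linD)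
      then have "(x + y) + (r x + r y) \<in> A'" by (simp add: ac_simps)
      then have "f (r (x + y)) = f (r x + r y)"
        using x y r sub \<open>lin B'\<close> by (intro f'I) (simp_all add: linD)
      then show ?thesis using r x y fD(3) by simp
    qed
    show "f (r (x \<circ> p)) = act S (f (r x)) p" if p: "p \<in> G" for p
    proof -
      have "submod B'" using sub B' submod_plus by simp
      have "(x \<circ> p) + (r x \<circ> p) \<in> A'"
        using submod_comp [OF sub(1) _ p, of "x + r x"] r [OF x] by (simp add: comp_add)
      then have "f (r (x \<circ> p)) = f (r x \<circ> p)"
        using x p r sub \<open>submod B'\<close> by (intro f'I) (simp_all add: submod_comp)
      then show ?thesis using r x p fD(4) by simp
    qed
    have "f (r x) = \<zero>\<^bsub>S\<^esub> \<longleftrightarrow> r x \<in> A'" using fD(5) r [OF x] A by auto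
    also have "\<dots> \<longleftrightarrow> x \<in> A'"
      using r [OF x] lin_add_cancel lin_add_cancel' sub submod_lin by blast
    finally show "f (r x) = \<zero>\<^bsub>S\<^esub> \<longleftrightarrow> x \<in> A'" .
  qed
  then show "factor_iso S A' B'" unfolding factor_iso_def by blast
next
  assume "factor_iso S A' B'"
  then obtain f where f: "factor_map S A' B' f" by (auto simp: factor_iso_def)
  note fD = factor_mapD [OF f]
  have BB': "B \<subseteq> B'" and AB': "A' \<subseteq> B'" using subset_plus1 subset_plus2 sub B' by auto
  interpret S: F2G_module Gr S by (rule S)
  have "f ` B = carrier S"
  proof
    show "f ` B \<subseteq> carrier S" using fD(2) BB' by auto
    show "carrier S \<subseteq> f ` B"
    proof
      fix s assume "s \<in> carrier S"
      then obtain x where x: "x \<in> B'" "s = f x" using fD(1) by auto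
      then obtain b a where ba: "b \<in> B" "a \<in> A'" "x = b + a" using B' by (auto elim!: set_plus_elim)
      then have "f x = f b \<oplus>\<^bsub>S\<^esub> f a" using fD(3) BB' AB' by blast
      also have "f a = \<zero>\<^bsub>S\<^esub>" using fD(5) ba AB' by blast
      also have "f b \<oplus>\<^bsub>S\<^esub> \<zero>\<^bsub>S\<^esub> = f b" using ba BB' fD(2) by (intro S.M.r_zero) blast
      finally have "s = f b" using x by simp
      then show "s \<in> f ` B" using ba by blast
    qed
  qed
  moreover have "f x = \<zero>\<^bsub>S\<^esub> \<longleftrightarrow> x \<in> A" if "x \<in> B" for x
    using fD(5) [of x] that BB' A by auto
  ultimately have "factor_map S A B f"
    using fD(3,4) subsetD [OF BB'] by (simp add: factor_map_def)
  then show "factor_iso S A B" unfolding factor_iso_def by blast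
qed

section \<open>Covers in the lattice of submodules\<close>

lemma coverD:
  assumes "cover A B"
  shows "submod A" "submod B" "A \<subset> B"
    "\<And>H. submod H \<Longrightarrow> A \<subseteq> H \<Longrightarrow> H \<subseteq> B \<Longrightarrow> H = A \<or> H = B"
  using assms unfolding cover_def by blast+

lemma cover_plus:
  assumes "cover A B" "submod H" "H \<subseteq> B" "\<not> H \<subseteq> A"
  shows "H + A = B"
proof -
  note AB = coverD [OF assms(1)]
  have "A \<subseteq> H + A" "H \<subseteq> H + A" using subset_plus1 subset_plus2 AB assms by auto
  moreover have "H + A \<subseteq> B" using plus_subset AB assms by auto
  ultimately show ?thesis using AB(4) [of "H + A"] submod_plus AB(1) assms(2,4) by blast
qed

text \<open>A submodule of least size among those strictly above \<open>A\<close> and inside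
  \<open>B\<close> covers \<open>A\<close>.\<close>

lemma cover_above:
  assumes "submod A" "submod B" "A \<subset> B"
  obtains C where "cover A C" "C \<subseteq> B"
proof -
  obtain C where C: "submod C \<and> A \<subset> C \<and> C \<subseteq> B"
    and least: "\<And>D. submod D \<and> A \<subset> D \<and> D \<subseteq> B \<Longrightarrow> card C \<le> card D"
    using ex_has_least_nat [of "\<lambda>C. submod C \<and> A \<subset> C \<and> C \<subseteq> B" B card] assms by blast
  have "H = A \<or> H = C" if "submod H" "A \<subseteq> H" "H \<subseteq> C" for H
  proof (rule ccontr)
    assume "\<not> (H = A \<or> H = C)"
    then have "card C \<le> card H" using least [of H] that C by blast
    moreover have "card H < card C"
      using \<open>\<not> (H = A \<or> H = C)\<close> that C by (intro psubset_card_mono) auto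
    ultimately show False by simp
  qed
  then show ?thesis using that [of C] C assms by (auto simp: cover_def)
qed

text \<open>On submodules \<open>perp\<close> is an inclusion-reversing involution, so it reverses
  covers.\<close>

lemma cover_perp:
  assumes "cover A B"
  shows "cover (perp B) (perp A)"
proof -
  note AB = coverD [OF assms]
  have pp: "perp (perp H) = H" if "submod H" for H using that by simp
  have "H = perp B \<or> H = perp A" if H: "submod H" "perp B \<subseteq> H" "H \<subseteq> perp A" for H
    using AB(4) [of "perp H"] submod_perp [OF H(1)] perp_anti [OF H(2)] perp_anti [OF H(3)]
      pp AB(1,2) H(1) by metis
  moreover have "perp B \<subset> perp A"
    using perp_anti [of A B] pp AB(1-3) by (metis psubset_eq)
  ultimately show ?thesis using AB(1,2) submod_perp by (auto simp: cover_def)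
qed

lemma cover_below:
  assumes "submod A" "submod B" "A \<subset> B"
  obtains C where "cover C B" "A \<subseteq> C"
proof -
  have "perp B \<subset> perp A"
    using perp_anti [of A B] assms perp_perp submod_lin by (metis psubset_eq)
  then obtain C where C: "cover (perp B) C" "C \<subseteq> perp A"
    using cover_above submod_perp assms(1,2) by metis
  show ?thesis
    using that [of "perp C"] cover_perp [OF C(1)] perp_anti [OF C(2)] assms by simp
qed

subsection \<open>Multiplicities\<close>

text \<open>For covers \<open>U < W\<close> and \<open>A < B\<close> in the lattice of submodules, the two conditions say that the
  factor \<open>W/U\<close> occurs in the step from \<open>A\<close> to \<open>B\<close>, and conversely.\<close>

lemma butterfly:
  assumes UW: "cover U W" and AB: "cover A B" and "\<not> W \<inter> B \<subseteq> U" "W \<inter> A \<subseteq> U"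
  shows "U \<inter> B \<subseteq> A" "\<not> W \<inter> B \<subseteq> A"
proof -
  note UWD = coverD [OF UW] and ABD = coverD [OF AB]
  show "\<not> W \<inter> B \<subseteq> A" using assms(3,4) by blast
  show "U \<inter> B \<subseteq> A"
  proof (rule ccontr)
    assume "\<not> U \<inter> B \<subseteq> A"
    \<comment> \<open>A vector \<open>x\<close> of \<open>W \<inter> B\<close> outside
      \<open>U\<close> would split as \<open>u + a\<close>. Then \<open>a\<close> lies in
      \<open>W \<inter> A\<close>, hence in \<open>U\<close>, and so does \<open>x\<close>.\<close>
    then have "(U \<inter> B) + A = B"
      using cover_plus [OF AB] submod_Int UWD(1) ABD(2) by blast
    moreover obtain x where x: "x \<in> W" "x \<in> B" "x \<notin> U" using assms(3) by blast
    ultimately have "x \<in> (U \<inter> B) + A" by simp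
    then obtain u a where ua: "u \<in> U" "a \<in> A" "x = u + a" by (auto elim!: set_plus_elim)
    then have "a \<in> W" using x UWD(1-3) lin_add_cancel [of W u a] by auto
    then have "x \<in> U" using assms(4) ua UWD(1) linD(3) submod_lin by blast
    then show False using x by simp
  qed
qed

lemma butterfly_iff:
  assumes "cover U W" "cover A B"
  shows "\<not> W \<inter> B \<subseteq> U \<and> W \<inter> A \<subseteq> U \<longleftrightarrow> U \<inter> B \<subseteq> A \<and> \<not> W \<inter> B \<subseteq> A"
  using butterfly [OF assms] butterfly [OF assms(2,1)] by (metis Int_commute)

text \<open>Both factors are isomorphic to \<open>(W \<inter> B) / (W \<inter> A)\<close> by the
  second isomorphism theorem.\<close>

lemma butterfly_factor_iso:
  assumes S: "F2G_module Gr S" and UW: "cover U W" and AB: "cover A B"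
    and 1: "\<not> W \<inter> B \<subseteq> U" "W \<inter> A \<subseteq> U"
  shows "factor_iso S U W \<longleftrightarrow> factor_iso S A B"
proof -
  note UWD = coverD [OF UW] and ABD = coverD [OF AB]
  have 2: "U \<inter> B \<subseteq> A" "\<not> W \<inter> B \<subseteq> A" using butterfly [OF UW AB 1] by auto
  have WB: "submod (W \<inter> B)" using UWD ABD submod_Int by auto
  have "(W \<inter> B) + U = W" "(W \<inter> B) + A = B"
    using cover_plus [OF UW WB] cover_plus [OF AB WB] 1 2 by auto
  moreover have "(W \<inter> B) \<inter> U = W \<inter> A" "(W \<inter> B) \<inter> A = W \<inter> A" using 1 2 UWD(3) ABD(3) by blast+
  ultimately show ?thesis
    using factor_iso_second_isomorphism [OF S UWD(1) WB, of "W \<inter> A" W]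
      factor_iso_second_isomorphism [OF S ABD(1) WB, of "W \<inter> A" B] by simp
qed

text \<open>Composition series in terms of \<open>cover\<close>. The top \<open>W\<close> may be any
  submodule, which allows the existence proof to proceed by induction on the size of
  \<open>W\<close>.\<close>

definition series :: "(nat \<Rightarrow> bit) set list \<Rightarrow> (nat \<Rightarrow> bit) set \<Rightarrow> bool" where
  "series Vs W \<longleftrightarrow> Vs \<noteq> [] \<and> Vs ! 0 = {0} \<and> Vs ! (length Vs - 1) = W
    \<and> (\<forall>i. Suc i < length Vs \<longrightarrow> cover (Vs ! i) (Vs ! Suc i))"

text \<open>The multiplicity of \<open>S\<close> in the submodule \<open>A\<close>, read off from a
  series of the whole module: a step counts if the trace of the series on \<open>A\<close> grows
  there. No series of \<open>A\<close> itself has to be chosen.\<close>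

definition mult_within ::
  "('s, nat \<Rightarrow> nat, 'd) gmodule_scheme \<Rightarrow> (nat \<Rightarrow> bit) set list \<Rightarrow> (nat \<Rightarrow> bit) set \<Rightarrow> nat" where
  "mult_within S Vs A = card {i. Suc i < length Vs \<and> factor_iso S (Vs ! i) (Vs ! Suc i)
     \<and> \<not> Vs ! Suc i \<inter> A \<subseteq> Vs ! i}"

lemma series_exists:
  assumes "submod W"
  shows "\<exists>Vs. series Vs W"
  using assms
proof (induction "card W" arbitrary: W rule: less_induct)
  case less
  show ?case
  proof (cases "W = {0}")
    case True
    then show ?thesis by (intro exI [of _ "[{0}]"]) (simp add: series_def)
  next
    case False
    then have "{0} \<subset> W" using less.prems linD(2) submod_lin by blast
    then obtain W' where W': "cover W' W" using cover_below submod_zero less.prems by metis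
    then have "card W' < card W" using less.prems by (intro psubset_card_mono) (auto simp: cover_def)
    then obtain Vs where "series Vs W'" using less.hyps W' coverD by metis
    then have "series (Vs @ [W]) W"
      using W' by (auto simp: series_def nth_append less_Suc_eq)
        (metis diff_Suc_1 One_nat_def)
    then show ?thesis by blast
  qed
qed

lemma series_submod:
  assumes "series Vs W" "submod W" "V' \<in> set Vs"
  shows "submod V'"
proof -
  obtain i where i: "i < length Vs" "V' = Vs ! i" using assms(3) by (auto simp: in_set_conv_nth)
  show ?thesis
  proof (cases "Suc i < length Vs")
    case True
    then show ?thesis using assms(1) i coverD(1) by (auto simp: series_def)
  next
    case False
    then have "i = length Vs - 1" using i by simp
    then show ?thesis using assms i by (auto simp: series_def)
  qed
qed

lemma composition_series_iff:
  "composition_series Gr (perm_module n) Vs \<longleftrightarrow> series Vs V"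
proof -
  have *: "Vs ! i \<subseteq> Vs ! Suc i \<and> simple_F2G_module Gr (series_factor (perm_module n) Vs i)
      \<longleftrightarrow> cover (Vs ! i) (Vs ! Suc i)"
    if "\<forall>W\<in>set Vs. submod W" "Suc i < length Vs" for i
    using that simple_subquotient_iff [of "Vs ! i" "Vs ! Suc i"] coverD(3) [of "Vs ! i" "Vs ! Suc i"]
    by (auto simp: series_factor_def)
  show ?thesis
    unfolding composition_series_def F2G_submodule_perm perm_module_simps
  proof (intro iffI; (elim conjE)?)
    assume "Vs \<noteq> []" "hd Vs = {0}" "last Vs = V" "\<forall>W\<in>set Vs. submod W"
      "\<forall>i. Suc i < length Vs \<longrightarrow> Vs ! i \<subseteq> Vs ! Suc i \<and> simple_F2G_module Gr (series_factor (perm_module n) Vs i)"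
    then show "series Vs V" using * by (simp add: series_def hd_conv_nth last_conv_nth)
  next
    assume "series Vs V"
    moreover from this have "\<forall>W\<in>set Vs. submod W" using series_submod submod_V by blast
    ultimately show "Vs \<noteq> [] \<and> hd Vs = {0} \<and> last Vs = V \<and> (\<forall>W\<in>set Vs. submod W) \<and>
        (\<forall>i. Suc i < length Vs \<longrightarrow> Vs ! i \<subseteq> Vs ! Suc i
          \<and> simple_F2G_module Gr (series_factor (perm_module n) Vs i))"
      using * by (simp add: series_def hd_conv_nth last_conv_nth)
  qed
qed

lemma F2G_iso_series_factor_iff:
  assumes "F2G_module Gr S" "series Vs V" "Suc i < length Vs"
  shows "F2G_iso Gr S (series_factor (perm_module n) Vs i) \<longleftrightarrow> factor_iso S (Vs ! i) (Vs ! Suc i)"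
  unfolding series_factor_def
  using assms F2G_iso_subquotient_iff [OF assms(1)] coverD [of "Vs ! i" "Vs ! Suc i"]
  by (auto simp: series_def)

lemma multiplicity_in_series_eq:
  assumes "F2G_module Gr S" "series Vs V"
  shows "multiplicity_in_series Gr S (perm_module n) Vs = mult_within S Vs V"
  unfolding multiplicity_in_series_def mult_within_def
proof (intro arg_cong [of _ _ card] Collect_cong)
  fix i
  have "\<not> Vs ! Suc i \<inter> V \<subseteq> Vs ! i" if "Suc i < length Vs"
  proof -
    have "cover (Vs ! i) (Vs ! Suc i)" using assms(2) that by (simp add: series_def)
    then show ?thesis using coverD(2,3) linD(1) submod_lin by blast
  qed
  then show "Suc i < length Vs \<and> F2G_iso Gr S (series_factor (perm_module n) Vs i)
    \<longleftrightarrow> Suc i < length Vs \<and> factor_iso S (Vs ! i) (Vs ! Suc i) \<and> \<not> Vs ! Suc i \<inter> V \<subseteq> Vs ! i"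
    using F2G_iso_series_factor_iff [OF assms] by blast
qed

text \<open>One step of the Jordan-Hoelder theorem: exactly one step of the series is met by
  \<open>B\<close> but not by \<open>A\<close>, and its factor is isomorphic to
  \<open>B/A\<close>.\<close>

lemma mult_within_cover:
  assumes S: "F2G_module Gr S" and Vs: "series Vs V" and AB: "cover A B"
  shows "mult_within S Vs B = mult_within S Vs A + (if factor_iso S A B then 1 else 0)"
proof -
  note ABD = coverD [OF AB]
  have cov: "cover (Vs ! i) (Vs ! Suc i)" if "Suc i < length Vs" for i
    using Vs that by (simp add: series_def)
  have mono: "Vs ! i \<subseteq> Vs ! j" if "i \<le> j" "j < length Vs" for i j
    using that
  proof (induction j rule: dec_induct)
    case (step m)
    then show ?case using coverD(3) [OF cov [of m]] by auto
  qed simp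
  \<comment> \<open>\<open>P i\<close> says that the trace of \<open>Vs ! i\<close> on
    \<open>B\<close> stays inside \<open>A\<close>. It holds for \<open>{0}\<close>, fails for
    \<open>V\<close>, and once it fails it keeps failing; \<open>i0\<close> is the last index at
    which it holds.\<close>
  define P where "P i \<longleftrightarrow> Vs ! i \<inter> B \<subseteq> A" for i
  have P0: "P 0" using Vs ABD(1) linD(2) by (auto simp: P_def series_def)
  have Pl: "\<not> P (length Vs - 1)"
    using Vs ABD(2,3) linD(1) [OF submod_lin [OF ABD(2)]] by (auto simp: P_def series_def)
  define k where "k = (LEAST i. \<not> P i)"
  have k: "\<not> P k" "k \<le> length Vs - 1" "\<And>i. i < k \<Longrightarrow> P i"
    unfolding k_def
    using LeastI [of "\<lambda>i. \<not> P i", OF Pl] Least_le [of "\<lambda>i. \<not> P i", OF Pl] not_less_Least [of _ "\<lambda>i. \<not> P i"]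
    by blast+
  then obtain i0 where i0: "k = Suc i0" using P0 by (cases k) auto
  have i0': "Suc i0 < length Vs" "P i0" "\<not> P (Suc i0)"
  proof -
    have "length Vs > 0" using Vs by (simp add: series_def)
    then show "Suc i0 < length Vs" using k(2) i0 by linarith
    show "P i0" "\<not> P (Suc i0)" using k(1,3) i0 by simp_all
  qed
  have unique: "i = i0" if "Suc i < length Vs" "P i" "\<not> P (Suc i)" for i
  proof (rule ccontr)
    assume "i \<noteq> i0"
    then consider "Suc i \<le> i0" | "Suc i0 \<le> i" by linarith
    then show False
    proof cases
      case 1
      then show ?thesis using mono [of "Suc i" i0] that i0' unfolding P_def by auto
    next
      case 2
      then show ?thesis using mono [of "Suc i0" i] that i0' unfolding P_def by auto
    qed
  qed
  have jump: "\<not> Vs ! Suc i \<inter> B \<subseteq> Vs ! i \<and> Vs ! Suc i \<inter> A \<subseteq> Vs ! i \<longleftrightarrow> i = i0"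
    if "Suc i < length Vs" for i
    using butterfly_iff [OF cov [OF that] AB] unique [OF that] i0' by (auto simp: P_def)
  let ?J = "\<lambda>X. {i. Suc i < length Vs \<and> factor_iso S (Vs ! i) (Vs ! Suc i) \<and> \<not> Vs ! Suc i \<inter> X \<subseteq> Vs ! i}"
  have fin: "finite (?J A)" by (rule finite_subset [of _ "{..<length Vs}"]) auto
  have i0A: "i0 \<notin> ?J A" using jump [OF i0'(1)] by blast
  have iff: "factor_iso S (Vs ! i0) (Vs ! Suc i0) \<longleftrightarrow> factor_iso S A B"
    using butterfly_factor_iso [OF S cov [OF i0'(1)] AB] jump [OF i0'(1)] by blast
  have "?J B = ?J A \<union> (if factor_iso S A B then {i0} else {})"
  proof (rule Set.set_eqI)
    fix i
    show "i \<in> ?J B \<longleftrightarrow> i \<in> ?J A \<union> (if factor_iso S A B then {i0} else {})"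
    proof (cases "Suc i < length Vs")
      case True
      then show ?thesis using jump [OF True] iff ABD(3) by (cases "i = i0") auto
    next
      case False
      then show ?thesis using i0' by auto
    qed
  qed
  then show ?thesis using fin i0A by (simp add: mult_within_def)
qed

lemma mult_within_zero:
  assumes "series Vs V"
  shows "mult_within S Vs {0} = 0"
proof -
  have "Vs ! Suc i \<inter> {0} \<subseteq> Vs ! i" if "Suc i < length Vs" for i
  proof -
    have "cover (Vs ! i) (Vs ! Suc i)" using assms that by (simp add: series_def)
    then show ?thesis using coverD(1) linD(2) submod_lin by blast
  qed
  then show ?thesis unfolding mult_within_def by (metis (mono_tags, lifting) card.empty empty_Collect_eq)
qed

lemma mult_within_mono:
  assumes "A \<subseteq> B"
  shows "mult_within S Vs A \<le> mult_within S Vs B"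
  unfolding mult_within_def using assms
  by (intro card_mono) (auto intro: finite_subset [of _ "{..<length Vs}"])

subsection \<open>Duality\<close>

text \<open>An additive map sends zero to zero, and this is all that compatibility with the scalars
  0 and 1 asks for.\<close>

lemma dual_carrier_iff:
  assumes "F2G_module Gr S"
  shows "h \<in> carrier (dual_module Gr S) \<longleftrightarrow> h \<in> extensional (carrier S)
    \<and> (\<forall>x\<in>carrier S. \<forall>y\<in>carrier S. h (x \<oplus>\<^bsub>S\<^esub> y) = h x + h y)"
proof -
  interpret S: F2G_module Gr S by fact
  have "h (a \<odot>\<^bsub>S\<^esub> x) = a * h x"
    if "\<forall>x\<in>carrier S. \<forall>y\<in>carrier S. h (x \<oplus>\<^bsub>S\<^esub> y) = h x + h y" "x \<in> carrier S" for a x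
  proof -
    have "h \<zero>\<^bsub>S\<^esub> = h \<zero>\<^bsub>S\<^esub> + h \<zero>\<^bsub>S\<^esub>" using that(1) by (metis S.M.zero_closed S.M.l_zero)
    then have "h \<zero>\<^bsub>S\<^esub> = 0" by (cases "h \<zero>\<^bsub>S\<^esub>") simp_all
    then show ?thesis using that(2) by (cases "a = 0") (simp_all add: S.smult_cases)
  qed
  then show ?thesis by (auto simp: dual_module_def)
qed

text \<open>The scalar product identifies \<open>perp A / perp B\<close> with functionals on
  \<open>B/A\<close>, and self-duality of \<open>S\<close> turns these functionals into elements of
  \<open>S\<close>. The resulting map has kernel \<open>perp B\<close>; it is onto because its image
  is a nonzero submodule of a simple module.\<close>

lemma factor_iso_perp:
  assumes simple: "simple_F2G_module Gr S" and dual: "self_dual_module Gr S"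
    and AB: "cover A B" and iso: "factor_iso S A B"
  shows "factor_iso S (perp B) (perp A)"
proof -
  note ABD = coverD [OF AB]
  have S: "F2G_module Gr S" using simple by (simp add: simple_F2G_module_def)
  interpret S: F2G_module Gr S by (rule S)
  obtain f where f: "factor_map S A B f" using iso by (auto simp: factor_iso_def)
  note fD = factor_mapD [OF f] and iD = factor_map_inv_into [OF f]
  note eqf = factor_map_eq_iff [OF S f submod_lin [OF ABD(2)]]
  have rep: "\<exists>x\<in>B. s = f x" if "s \<in> carrier S" for s using that fD(1) by auto
  let ?D = "dual_module Gr S"
  obtain \<theta> where \<theta>: "bij_betw \<theta> (carrier S) (carrier ?D)"
    "\<And>x y. x \<in> carrier S \<Longrightarrow> y \<in> carrier S \<Longrightarrow> \<theta> (x \<oplus>\<^bsub>S\<^esub> y) = \<theta> x \<oplus>\<^bsub>?D\<^esub> \<theta> y"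
    "\<And>x p. x \<in> carrier S \<Longrightarrow> p \<in> G \<Longrightarrow> \<theta> (act S x p) = act ?D (\<theta> x) p"
    using dual by (auto simp: self_dual_module_def F2G_iso_def)
  have inj: "inj_on \<theta> (carrier S)" using \<theta>(1) by (simp add: bij_betw_def)
  define h where "h y = (\<lambda>s\<in>carrier S. dot y (inv_into B f s))" for y
  have h: "h y (f x) = dot y x" if "y \<in> perp A" "x \<in> B" for x y
  proof -
    have "inv_into B f (f x) + x \<in> A" using eqf iD fD(2) that by metis
    then have "dot y (inv_into B f (f x) + x) = 0" using that by (auto simp: perp_def)
    then show ?thesis using that fD(2) by (cases "dot y x"; cases "dot y (inv_into B f (f x))") (simp_all add: h_def dot_add_right)
  qed
  have h_eqI: "h y = g" if "y \<in> perp A" "g \<in> extensional (carrier S)" "\<And>x. x \<in> B \<Longrightarrow> dot y x = g (f x)" for y g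
  proof (rule extensionalityI [of _ "carrier S"])
    show "h y \<in> extensional (carrier S)" by (simp add: h_def)
    show "h y s = g s" if "s \<in> carrier S" for s using rep [OF that] h \<open>y \<in> perp A\<close> that \<open>\<And>x. x \<in> B \<Longrightarrow> dot y x = g (f x)\<close> by auto
  qed (rule that)
  have hD: "h y \<in> carrier ?D" if "y \<in> perp A" for y
    unfolding dual_carrier_iff [OF S]
  proof (intro conjI ballI)
    show "h y \<in> extensional (carrier S)" by (simp add: h_def)
    fix s t assume "s \<in> carrier S" "t \<in> carrier S"
    then obtain x x' where "x \<in> B" "s = f x" "x' \<in> B" "t = f x'" using rep by metis
    then show "h y (s \<oplus>\<^bsub>S\<^esub> t) = h y s + h y t"
      using h [OF that] ABD(2) by (simp add: linD dot_add_right flip: fD(3))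
  qed
  define g where "g y = inv_into (carrier S) \<theta> (h y)" for y
  have g: "g y \<in> carrier S" "\<theta> (g y) = h y" if "y \<in> perp A" for y
  proof -
    have "h y \<in> \<theta> ` carrier S" using \<theta>(1) hD [OF that] by (simp add: bij_betw_def)
    then show "g y \<in> carrier S" "\<theta> (g y) = h y"
      using inv_into_into [of "h y" \<theta> "carrier S"] f_inv_into_f [of "h y" \<theta> "carrier S"] by (auto simp: g_def)
  qed
  have gI: "g y = s" if "y \<in> perp A" "s \<in> carrier S" "\<theta> s = h y" for y s
    using inj_onD [OF inj, of "g y" s] g [OF that(1)] that by simp
  have pA: "submod (perp A)" and pB: "submod (perp B)" using submod_perp ABD by auto
  have pBA: "perp B \<subset> perp A" using coverD(3) [OF cover_perp [OF AB]] .
  have g_add: "g (x + y) = g x \<oplus>\<^bsub>S\<^esub> g y" if xy: "x \<in> perp A" "y \<in> perp A" for x y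
  proof (rule gI)
    show "x + y \<in> perp A" using xy pA by (simp add: linD)
    show "g x \<oplus>\<^bsub>S\<^esub> g y \<in> carrier S" using g xy by simp
    have "h (x + y) = (\<lambda>s\<in>carrier S. h x s + h y s)"
      using xy pA fD(2) h by (intro h_eqI) (auto simp: linD dot_add_left)
    then show "\<theta> (g x \<oplus>\<^bsub>S\<^esub> g y) = h (x + y)" using \<theta>(2) g xy by (simp add: dual_module_def)
  qed
  have g_act: "g (x \<circ> p) = act S (g x) p" if xp: "x \<in> perp A" "p \<in> G" for x p
  proof (rule gI)
    show "x \<circ> p \<in> perp A" using xp pA by (simp add: submod_comp)
    show "act S (g x) p \<in> carrier S" using g xp S.act_closed by simp
    \<comment> \<open>The inverse in the action on the dual arises because the adjoint of a
      permutation with respect to \<open>dot\<close> is its inverse.\<close>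
    have "h (x \<circ> p) = (\<lambda>s\<in>carrier S. h x (act S s (inv\<^bsub>Gr\<^esub> p)))"
    proof (rule h_eqI)
      show "dot (x \<circ> p) z = (\<lambda>s\<in>carrier S. h x (act S s (inv\<^bsub>Gr\<^esub> p))) (f z)" if "z \<in> B" for z
        using that xp h [of x "z \<circ> inv' p"] submod_comp [OF ABD(2) that] fD(2,4) inv_Gr [OF xp(2)]
        by (simp add: dot_comp_inv)
    qed (use xp pA submod_comp in auto)
    then show "\<theta> (act S (g x) p) = h (x \<circ> p)" using \<theta>(3) g xp by (simp add: dual_module_def)
  qed
  have \<theta>0: "\<theta> \<zero>\<^bsub>S\<^esub> = (\<lambda>s\<in>carrier S. 0)"
  proof -
    have "\<theta> \<zero>\<^bsub>S\<^esub> = \<theta> \<zero>\<^bsub>S\<^esub> \<oplus>\<^bsub>?D\<^esub> \<theta> \<zero>\<^bsub>S\<^esub>" using \<theta>(2) [of "\<zero>\<^bsub>S\<^esub>" "\<zero>\<^bsub>S\<^esub>"] by simp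
    then show ?thesis by (simp add: dual_module_def)
  qed
  have g_zero: "g y = \<zero>\<^bsub>S\<^esub> \<longleftrightarrow> y \<in> perp B" if y: "y \<in> perp A" for y
  proof
    assume "g y = \<zero>\<^bsub>S\<^esub>"
    then have "h y = (\<lambda>s\<in>carrier S. 0)" using g [OF y] \<theta>0 by simp
    then have "dot y x = 0" if "x \<in> B" for x using h [OF y that] fD(2) [OF that] by simp
    then show "y \<in> perp B" using y by (auto simp: perp_def)
  next
    assume "y \<in> perp B"
    then have "h y = (\<lambda>s\<in>carrier S. 0)"
      using fD(2) by (intro h_eqI [OF y]) (auto simp: perp_def)
    then show "g y = \<zero>\<^bsub>S\<^esub>" using \<theta>0 by (intro gI [OF y]) simp_all
  qed
  have "F2G_submodule Gr (g ` perp A) S"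
    unfolding S.F2G_submodule_iff
  proof (intro conjI ballI)
    show "g ` perp A \<subseteq> carrier S" using g by auto
    show "\<zero>\<^bsub>S\<^esub> \<in> g ` perp A" using g_zero [of 0] linD(2) [OF lin_perp] by (metis imageI)
    fix s assume "s \<in> g ` perp A"
    then obtain x where x: "x \<in> perp A" "s = g x" by blast
    show "s \<oplus>\<^bsub>S\<^esub> t \<in> g ` perp A" if "t \<in> g ` perp A" for t
      using x that pA by (auto simp: linD simp flip: g_add)
    show "act S s p \<in> g ` perp A" if "p \<in> carrier Gr" for p
      using x that pA by (auto simp: submod_comp simp flip: g_act)
  qed
  moreover have "g ` perp A \<noteq> {\<zero>\<^bsub>S\<^esub>}" using g_zero pBA by auto
  ultimately have "g ` perp A = carrier S" using simple by (auto simp: simple_F2G_module_def)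
  then have "factor_map S (perp B) (perp A) g"
    unfolding factor_map_def using g_add g_act g_zero by blast
  then show ?thesis unfolding factor_iso_def by blast
qed

lemma factor_iso_perp_iff:
  assumes "simple_F2G_module Gr S" "self_dual_module Gr S" "cover A B"
  shows "factor_iso S (perp B) (perp A) \<longleftrightarrow> factor_iso S A B"
  using factor_iso_perp [OF assms] factor_iso_perp [OF assms(1,2) cover_perp [OF assms(3)]]
    coverD(1,2) [OF assms(3)] by auto

text \<open>Going up a cover from \<open>W'\<close> to \<open>W\<close> adds the factor
  \<open>W/W'\<close> to the first summand and removes \<open>perp W' / perp W\<close> from the
  second; \<open>S\<close> is isomorphic to both or to neither.\<close>

lemma mult_within_perp:
  assumes S: "simple_F2G_module Gr S" "self_dual_module Gr S" and Vs: "series Vs V" and W: "submod W"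
  shows "mult_within S Vs W + mult_within S Vs (perp W) = mult_within S Vs V"
  using W
proof (induction "card W" arbitrary: W rule: less_induct)
  case less
  have S': "F2G_module Gr S" using S by (simp add: simple_F2G_module_def)
  show ?case
  proof (cases "W = {0}")
    case True
    then show ?thesis using mult_within_zero [OF Vs] by simp
  next
    case False
    then have "{0} \<subset> W" using less.prems linD(2) submod_lin by blast
    then obtain W' where W': "cover W' W" using cover_below submod_zero less.prems by metis
    then have "card W' < card W" using less.prems by (intro psubset_card_mono) (auto simp: cover_def)
    then have "mult_within S Vs W' + mult_within S Vs (perp W') = mult_within S Vs V"
      using less.hyps W' coverD by metis
    then show ?thesis
      using mult_within_cover [OF S' Vs W'] mult_within_cover [OF S' Vs cover_perp [OF W']]
        factor_iso_perp_iff [OF S W'] by simp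
  qed
qed

subsection \<open>Nondegenerate invariant forms\<close>

text \<open>A nondegenerate symmetric bilinear form preserved by \<open>G\<close>. The last clause
  makes it represent every functional, so that it identifies \<open>S\<close> with its dual without
  a dimension count.\<close>

definition invariant_form ::
  "('s, nat \<Rightarrow> nat, 'd) gmodule_scheme \<Rightarrow> ('s \<Rightarrow> 's \<Rightarrow> bit) \<Rightarrow> bool" where
  "invariant_form S \<beta> \<longleftrightarrow>
     (\<forall>s\<in>carrier S. \<forall>t\<in>carrier S. \<beta> s t = \<beta> t s) \<and>
     (\<forall>s\<in>carrier S. \<forall>t\<in>carrier S. \<forall>u\<in>carrier S. \<beta> (s \<oplus>\<^bsub>S\<^esub> t) u = \<beta> s u + \<beta> t u) \<and>
     (\<forall>s\<in>carrier S. \<forall>t\<in>carrier S. \<forall>p\<in>G. \<beta> (act S s p) (act S t p) = \<beta> s t) \<and>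
     (\<forall>s\<in>carrier S. (\<forall>t\<in>carrier S. \<beta> s t = 0) \<longrightarrow> s = \<zero>\<^bsub>S\<^esub>) \<and>
     (\<forall>h. (\<forall>s\<in>carrier S. \<forall>t\<in>carrier S. h (s \<oplus>\<^bsub>S\<^esub> t) = h s + h t)
        \<longrightarrow> (\<exists>s\<in>carrier S. \<forall>t\<in>carrier S. h t = \<beta> s t))"

lemma invariant_formD:
  assumes "invariant_form S \<beta>"
  shows "\<And>s t. s \<in> carrier S \<Longrightarrow> t \<in> carrier S \<Longrightarrow> \<beta> s t = \<beta> t s"
    and "\<And>s t u. s \<in> carrier S \<Longrightarrow> t \<in> carrier S \<Longrightarrow> u \<in> carrier S
      \<Longrightarrow> \<beta> (s \<oplus>\<^bsub>S\<^esub> t) u = \<beta> s u + \<beta> t u"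
    and "\<And>s t p. s \<in> carrier S \<Longrightarrow> t \<in> carrier S \<Longrightarrow> p \<in> G \<Longrightarrow> \<beta> (act S s p) (act S t p) = \<beta> s t"
    and "\<And>s. s \<in> carrier S \<Longrightarrow> (\<And>t. t \<in> carrier S \<Longrightarrow> \<beta> s t = 0) \<Longrightarrow> s = \<zero>\<^bsub>S\<^esub>"
  using assms unfolding invariant_form_def by simp_all

lemma invariant_form_represents:
  assumes \<beta>: "invariant_form S \<beta>"
    and h: "\<And>s t. s \<in> carrier S \<Longrightarrow> t \<in> carrier S \<Longrightarrow> h (s \<oplus>\<^bsub>S\<^esub> t) = h s + h t"
  shows "\<exists>s\<in>carrier S. \<forall>t\<in>carrier S. h t = \<beta> s t"
proof -
  have "(\<forall>s\<in>carrier S. \<forall>t\<in>carrier S. h (s \<oplus>\<^bsub>S\<^esub> t) = h s + h t)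
      \<longrightarrow> (\<exists>s\<in>carrier S. \<forall>t\<in>carrier S. h t = \<beta> s t)"
    using \<beta> unfolding invariant_form_def by (elim conjE allE [of _ h])
  then show ?thesis using h by simp
qed

lemma invariant_form_act:
  assumes "F2G_module Gr S" "invariant_form S \<beta>" "s \<in> carrier S" "t \<in> carrier S" "p \<in> G"
  shows "\<beta> (act S s p) t = \<beta> s (act S t (inv\<^bsub>Gr\<^esub> p))"
proof -
  interpret S: F2G_module Gr S by fact
  have "act S (act S t (inv\<^bsub>Gr\<^esub> p)) p = t"
    using S.act_mult [of t "inv\<^bsub>Gr\<^esub> p" p] S.act_one [of t] inv_Gr(1) [of p] S.grp.l_inv [of p] assms(4,5)
    by simp
  then show ?thesis
    using invariant_formD(3) [OF assms(2,3), of "act S t (inv\<^bsub>Gr\<^esub> p)" p] S.act_closed inv_Gr(1) assms(4,5)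
    by simp
qed

lemma invariant_form_eq:
  assumes S: "F2G_module Gr S" and \<beta>: "invariant_form S \<beta>" and st: "s \<in> carrier S" "t \<in> carrier S"
    and eq: "\<And>u. u \<in> carrier S \<Longrightarrow> \<beta> s u = \<beta> t u"
  shows "s = t"
proof -
  interpret S: F2G_module Gr S by (rule S)
  have "\<beta> (s \<oplus>\<^bsub>S\<^esub> t) u = 0" if "u \<in> carrier S" for u
    using invariant_formD(2) [OF \<beta> st that] eq [OF that] by (cases "\<beta> t u") simp_all
  then show ?thesis
    using invariant_formD(4) [OF \<beta>, of "s \<oplus>\<^bsub>S\<^esub> t"] S.add_eq_zero_iff st by simp
qed

text \<open>The isomorphism sends \<open>s\<close> to the functional \<open>\<beta> s\<close>; it is
  injective by nondegeneracy and onto by the last clause of \<open>invariant_form\<close>.\<close>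

lemma self_dual_if_invariant_form:
  assumes S: "F2G_module Gr S" and \<beta>: "invariant_form S \<beta>"
  shows "self_dual_module Gr S"
proof -
  interpret S: F2G_module Gr S by (rule S)
  note \<beta>D = invariant_formD [OF \<beta>]
  let ?D = "dual_module Gr S"
  define \<theta> where "\<theta> s = (\<lambda>t\<in>carrier S. \<beta> s t)" for s
  have \<theta>D: "\<theta> s \<in> carrier ?D" if "s \<in> carrier S" for s
    unfolding dual_carrier_iff [OF S] \<theta>_def using that \<beta>D(1,2) by simp
  have "bij_betw \<theta> (carrier S) (carrier ?D)"
    unfolding bij_betw_def
  proof
    show "inj_on \<theta> (carrier S)"
    proof (rule inj_onI)
      fix s t assume st: "s \<in> carrier S" "t \<in> carrier S" "\<theta> s = \<theta> t"
      have "\<beta> s u = \<beta> t u" if "u \<in> carrier S" for u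
        using fun_cong [OF st(3), of u] that by (simp add: \<theta>_def)
      then show "s = t" using invariant_form_eq [OF S \<beta>] st by blast
    qed
    show "\<theta> ` carrier S = carrier ?D"
    proof
      show "\<theta> ` carrier S \<subseteq> carrier ?D" using \<theta>D by auto
      show "carrier ?D \<subseteq> \<theta> ` carrier S"
      proof
        fix h assume "h \<in> carrier ?D"
        then have h: "h \<in> extensional (carrier S)"
          "\<And>s t. s \<in> carrier S \<Longrightarrow> t \<in> carrier S \<Longrightarrow> h (s \<oplus>\<^bsub>S\<^esub> t) = h s + h t"
          unfolding dual_carrier_iff [OF S] by auto
        then obtain s where s: "s \<in> carrier S" "\<forall>t\<in>carrier S. h t = \<beta> s t" using invariant_form_represents [OF \<beta>, of h] by blast
        then have "h = \<theta> s" using h(1) by (intro extensionalityI [of _ "carrier S"]) (auto simp: \<theta>_def)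
        then show "h \<in> \<theta> ` carrier S" using s(1) by blast
      qed
    qed
  qed
  moreover have "\<theta> (s \<oplus>\<^bsub>S\<^esub> t) = \<theta> s \<oplus>\<^bsub>?D\<^esub> \<theta> t" if "s \<in> carrier S" "t \<in> carrier S" for s t
    using that \<beta>D(2) by (auto simp: \<theta>_def dual_module_def intro!: restrict_ext)
  moreover have "\<theta> (a \<odot>\<^bsub>S\<^esub> s) = a \<odot>\<^bsub>?D\<^esub> \<theta> s" if s: "s \<in> carrier S" for a s
  proof -
    have "\<beta> \<zero>\<^bsub>S\<^esub> t = 0" if "t \<in> carrier S" for t
      using \<beta>D(2) [of "\<zero>\<^bsub>S\<^esub>" "\<zero>\<^bsub>S\<^esub>" t] that by (cases "\<beta> \<zero>\<^bsub>S\<^esub> t") simp_all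
    then show ?thesis
      using s by (cases "a = 0") (auto simp: S.smult_cases \<theta>_def dual_module_def intro!: restrict_ext)
  qed
  moreover have "\<theta> (act S s p) = act ?D (\<theta> s) p" if "s \<in> carrier S" "p \<in> G" for s p
    using that invariant_form_act [OF S \<beta>] S.act_closed inv_Gr(1)
    by (auto simp: \<theta>_def dual_module_def intro!: restrict_ext)
  ultimately show ?thesis unfolding self_dual_module_def F2G_iso_def by (intro exI [of _ \<theta>]) simp
qed

text \<open>The radical of the scalar product on \<open>A\<close> is
  \<open>A \<inter> perp A\<close>, the kernel of \<open>f\<close>, so the scalar product descends
  to a nondegenerate form on \<open>S\<close>.\<close>

lemma invariant_form_factor:
  assumes S: "F2G_module Gr S" and A: "submod A" and D: "D = A \<inter> perp A" and f: "factor_map S D A f"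
  obtains \<beta> where "invariant_form S \<beta>" "\<And>x y. x \<in> A \<Longrightarrow> y \<in> A \<Longrightarrow> \<beta> (f x) (f y) = dot x y"
proof -
  note fD = factor_mapD [OF f] and iD = factor_map_inv_into [OF f]
  note eqf = factor_map_eq_iff [OF S f submod_lin [OF A]]
  have rep: "\<exists>x\<in>A. s = f x" if "s \<in> carrier S" for s using that fD(1) by auto
  define \<beta> where "\<beta> s t = dot (inv_into A f s) (inv_into A f t)" for s t
  have dotD: "dot x y = 0" "dot y x = 0" if "x \<in> D" "y \<in> A" for x y
    using that D by (auto simp: perp_def dot_commute)
  have \<beta>: "\<beta> (f x) (f y) = dot x y" if xy: "x \<in> A" "y \<in> A" for x y
  proof -
    define x' y' where "x' = inv_into A f (f x)" and "y' = inv_into A f (f y)"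
    have x': "x' \<in> A" "x' + x \<in> D" using iD [of "f x"] fD(2) xy eqf [of x' x] by (auto simp: x'_def)
    have y': "y' \<in> A" "y' + y \<in> D" using iD [of "f y"] fD(2) xy eqf [of y' y] by (auto simp: y'_def)
    have "dot (x' + x) y' = 0" "dot x (y' + y) = 0" using dotD x' y' xy by auto
    then have "dot x' y' = dot x y"
      by (cases "dot x' y'"; cases "dot x y'"; cases "dot x y") (simp_all add: dot_add_left dot_add_right)
    then show ?thesis by (simp add: \<beta>_def x'_def y'_def)
  qed
  have "invariant_form S \<beta>"
    unfolding invariant_form_def
  proof (intro conjI ballI allI impI)
    fix s assume "s \<in> carrier S"
    then obtain x where x: "x \<in> A" "s = f x" using rep by blast
    { fix t assume "t \<in> carrier S"
      then obtain y where y: "y \<in> A" "t = f y" using rep by blast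
      show "\<beta> s t = \<beta> t s" using x y by (simp add: \<beta> dot_commute)
      show "\<beta> (s \<oplus>\<^bsub>S\<^esub> t) u = \<beta> s u + \<beta> t u" if "u \<in> carrier S" for u
        using rep [OF that] x y A by (auto simp: \<beta> linD dot_add_left simp flip: fD(3))
      show "\<beta> (act S s p) (act S t p) = \<beta> s t" if "p \<in> G" for p
        using that x y A dot_comp [OF G_permutes [OF that]] by (simp add: \<beta> submod_comp flip: fD(4))
    }
    show "s = \<zero>\<^bsub>S\<^esub>" if "\<forall>t\<in>carrier S. \<beta> s t = 0"
    proof -
      have "dot x y = 0" if "y \<in> A" for y
        using \<open>\<forall>t\<in>carrier S. \<beta> s t = 0\<close> \<beta> [OF x(1) that] fD(2) [OF that] x(2) by simp
      then have "x \<in> D" using x linD(1) [OF submod_lin [OF A]] by (auto simp: D perp_def)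
      then show ?thesis using fD(5) x by simp
    qed
  next
    fix h :: "_ \<Rightarrow> bit" assume h: "\<forall>s\<in>carrier S. \<forall>t\<in>carrier S. h (s \<oplus>\<^bsub>S\<^esub> t) = h s + h t"
    have add: "h (f (x + y)) = h (f x) + h (f y)" if "x \<in> A" "y \<in> A" for x y
      using h that fD(2,3) by simp
    then obtain y where y: "y \<in> V" "\<And>x. x \<in> A \<Longrightarrow> h (f x) = dot y x"
      using linear_functional_dot [OF submod_lin [OF A], of "\<lambda>x. h (f x)"] by blast
    have "dot y d = 0" if "d \<in> D" for d
    proof -
      have "d \<in> A" "0 \<in> A" using that D A by (auto simp: linD)
      moreover have "f d = f 0" using eqf [OF calculation] that by simp
      ultimately show ?thesis using y(2) [of d] y(2) [of 0] by simp
    qed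
    then have "y \<in> perp D" using y by (auto simp: perp_def)
    \<comment> \<open>The vector \<open>y\<close> representing the functional is orthogonal to the
      radical. Its component in \<open>perp A\<close> is invisible on \<open>A\<close>, so the
      component in \<open>A\<close> represents the same functional.\<close>
    also have "perp D = perp A + A" using A by (simp add: D perp_Int)
    finally obtain a' a where a: "a' \<in> perp A" "a \<in> A" "y = a' + a" by (auto elim!: set_plus_elim)
    have "h t = \<beta> (f a) t" if "t \<in> carrier S" for t
    proof -
      obtain x where x: "x \<in> A" "t = f x" using rep \<open>t \<in> carrier S\<close> by blast
      then have "dot a' x = 0" using a(1) by (simp add: perp_def)
      then show ?thesis using x y(2) a by (simp add: \<beta> dot_add_left)
    qed
    then show "\<exists>s\<in>carrier S. \<forall>t\<in>carrier S. h t = \<beta> s t" using a(2) fD(2) by blast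
  qed
  then show ?thesis using that \<beta> by blast
qed

section \<open>Automorphisms of a simple module and isometries of its forms\<close>

definition automorphism :: "('s, nat \<Rightarrow> nat, 'd) gmodule_scheme \<Rightarrow> ('s \<Rightarrow> 's) \<Rightarrow> bool" where
  "automorphism S a \<longleftrightarrow> a permutes carrier S
    \<and> (\<forall>s\<in>carrier S. \<forall>t\<in>carrier S. a (s \<oplus>\<^bsub>S\<^esub> t) = a s \<oplus>\<^bsub>S\<^esub> a t)
    \<and> (\<forall>s\<in>carrier S. \<forall>p\<in>G. a (act S s p) = act S (a s) p)"

lemma automorphism_closed: "automorphism S a \<Longrightarrow> a s \<in> carrier S \<longleftrightarrow> s \<in> carrier S"
  using permutes_in_image [of a "carrier S" s] by (simp add: automorphism_def)

lemma automorphism_funpow: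
  assumes "automorphism S a"
  shows "automorphism S (a ^^ k)"
proof (induction k)
  case 0
  then show ?case using permutes_id [of "carrier S"] by (simp add: automorphism_def id_def)
next
  case (Suc k)
  then show ?case
    using assms automorphism_closed [OF Suc] permutes_compose [of "a ^^ k" "carrier S" a]
    by (auto simp: automorphism_def o_def)
qed

text \<open>An involutory automorphism fixes every \<open>s + a s\<close>, hence a nonzero submodule.\<close>

lemma automorphism_involution_id:
  assumes S: "simple_F2G_module Gr S" and a: "automorphism S a" and aa: "a \<circ> a = id"
  shows "a = id"
proof -
  interpret S: F2G_module Gr S using S by (simp add: simple_F2G_module_def)
  define K where "K = {s \<in> carrier S. a s = s}"
  have aD: "\<And>s t. s \<in> carrier S \<Longrightarrow> t \<in> carrier S \<Longrightarrow> a (s \<oplus>\<^bsub>S\<^esub> t) = a s \<oplus>\<^bsub>S\<^esub> a t"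
    "\<And>s p. s \<in> carrier S \<Longrightarrow> p \<in> G \<Longrightarrow> a (act S s p) = act S (a s) p"
    "\<And>s. s \<in> carrier S \<Longrightarrow> a s \<in> carrier S" "\<And>s. a (a s) = s"
    using a automorphism_closed [OF a] fun_cong [OF aa] by (auto simp: automorphism_def)
  have a0: "a \<zero>\<^bsub>S\<^esub> = \<zero>\<^bsub>S\<^esub>"
    using aD(1) [of "\<zero>\<^bsub>S\<^esub>" "\<zero>\<^bsub>S\<^esub>"] aD(3) [of "\<zero>\<^bsub>S\<^esub>"] S.add_self by simp
  have "F2G_submodule Gr K S"
    unfolding S.F2G_submodule_iff using aD a0 S.act_closed by (auto simp: K_def)
  moreover have "K \<noteq> {\<zero>\<^bsub>S\<^esub>}"
  proof
    assume K: "K = {\<zero>\<^bsub>S\<^esub>}"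
    have "s = \<zero>\<^bsub>S\<^esub>" if s: "s \<in> carrier S" for s
    proof -
      have "a (s \<oplus>\<^bsub>S\<^esub> a s) = s \<oplus>\<^bsub>S\<^esub> a s" using aD s S.M.a_comm by simp
      then have "s \<oplus>\<^bsub>S\<^esub> a s = \<zero>\<^bsub>S\<^esub>" using K aD(3) s by (auto simp: K_def)
      then have "a s = s" using S.add_eq_zero_iff aD(3) s by metis
      then show ?thesis using K s by (auto simp: K_def)
    qed
    then show False using S by (auto simp: simple_F2G_module_def)
  qed
  ultimately have "K = carrier S" using S by (auto simp: simple_F2G_module_def)
  then show ?thesis
    using a permutes_not_in [of a "carrier S"] by (fastforce simp: K_def automorphism_def fun_eq_iff)
qed

text \<open>The two forms differ by a self-adjoint automorphism, whose order is odd; its square root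
  among its own powers is again self-adjoint.\<close>

lemma invariant_forms_isometric:
  assumes S: "simple_F2G_module Gr S" and fin: "finite (carrier S)"
    and \<beta>: "invariant_form S \<beta>" and \<gamma>: "invariant_form S \<gamma>"
  obtains c where "automorphism S c"
    "\<And>s t. s \<in> carrier S \<Longrightarrow> t \<in> carrier S \<Longrightarrow> \<gamma> s t = \<beta> (c s) (c t)"
proof -
  have S': "F2G_module Gr S" using S by (simp add: simple_F2G_module_def)
  interpret S: F2G_module Gr S by (rule S')
  note \<beta>D = invariant_formD [OF \<beta>] and \<gamma>D = invariant_formD [OF \<gamma>]
  have "\<exists>s'\<in>carrier S. \<forall>t\<in>carrier S. \<gamma> s t = \<beta> s' t" if "s \<in> carrier S" for s
    using that invariant_formD(1,2) [OF \<gamma>] by (intro invariant_form_represents [OF \<beta>]) simp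
  then obtain a0 where a0: "\<And>s. s \<in> carrier S \<Longrightarrow> a0 s \<in> carrier S"
    "\<And>s t. s \<in> carrier S \<Longrightarrow> t \<in> carrier S \<Longrightarrow> \<gamma> s t = \<beta> (a0 s) t"
    by metis
  \<comment> \<open>Extending by the identity makes \<open>a\<close> a permutation in the sense of
    \<open>permutes\<close>, so that its powers reach \<open>id\<close>.\<close>
  define a where "a s = (if s \<in> carrier S then a0 s else s)" for s
  have a: "\<And>s. s \<in> carrier S \<Longrightarrow> a s \<in> carrier S"
    "\<And>s t. s \<in> carrier S \<Longrightarrow> t \<in> carrier S \<Longrightarrow> \<beta> (a s) t = \<gamma> s t"
    using a0 by (auto simp: a_def)
  have "automorphism S a"
    unfolding automorphism_def
  proof (intro conjI ballI)
    have "inj_on a (carrier S)"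
    proof (rule inj_onI)
      fix s t assume "s \<in> carrier S" "t \<in> carrier S" "a s = a t"
      then show "s = t" using a(2) by (intro invariant_form_eq [OF S' \<gamma>]) (auto, metis)
    qed
    moreover have "a ` carrier S = carrier S"
      using calculation a(1) fin by (intro endo_inj_surj) auto
    ultimately show "a permutes carrier S"
      by (intro bij_imp_permutes) (auto simp: bij_betw_def a_def)
    fix s assume s: "s \<in> carrier S"
    show "a (s \<oplus>\<^bsub>S\<^esub> t) = a s \<oplus>\<^bsub>S\<^esub> a t" if "t \<in> carrier S" for t
      using s that a \<beta>D(2) \<gamma>D(2) by (intro invariant_form_eq [OF S' \<beta>]) auto
    show "a (act S s p) = act S (a s) p" if "p \<in> G" for p
      using s that a S.act_closed inv_Gr(1) invariant_form_act [OF S' \<beta>] invariant_form_act [OF S' \<gamma>]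
      by (intro invariant_form_eq [OF S' \<beta>]) auto
  qed
  note aut = this
  note closed = automorphism_closed [OF automorphism_funpow [OF aut]]
  \<comment> \<open>Symmetry of both forms makes \<open>a\<close> self-adjoint for
    \<open>\<beta>\<close>, and this passes to all powers.\<close>
  have adj: "\<beta> ((a ^^ k) s) t = \<beta> s ((a ^^ k) t)" if "s \<in> carrier S" "t \<in> carrier S" for k s t
    using that
  proof (induction k arbitrary: s t)
    case (Suc k)
    have "\<beta> ((a ^^ Suc k) s) t = \<gamma> ((a ^^ k) s) t"
      using Suc.prems closed a(2) by simp
    also have "\<dots> = \<beta> (a t) ((a ^^ k) s)"
      using Suc.prems closed a(2) \<gamma>D(1) by simp
    also have "\<dots> = \<beta> ((a ^^ k) s) (a t)"
      using Suc.prems closed a(1) \<beta>D(1) by simp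
    also have "\<dots> = \<beta> s ((a ^^ k) (a t))"
      using Suc.prems a(1) by (intro Suc.IH) simp_all
    finally show ?case by (simp add: funpow_swap1)
  qed simp
  have "permutation a"
    unfolding permutation_permutes using aut fin by (auto simp: automorphism_def)
  then obtain k where "k > 0 \<and> a ^^ k = id"
    using permutation_is_nilpotent' [of a 0] by blast
  then obtain m where m: "m > 0" "a ^^ m = id" and least: "\<And>k. k > 0 \<Longrightarrow> a ^^ k = id \<Longrightarrow> m \<le> k"
    using ex_has_least_nat [of "\<lambda>k. k > 0 \<and> a ^^ k = id" k "\<lambda>k. k"] by blast
  have "odd m"
  proof
    assume "even m"
    then obtain j where j: "m = j + j" by (metis evenE mult_2)
    then have "a ^^ j \<circ> a ^^ j = id" using m by (simp add: funpow_add)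
    then have "a ^^ j = id"
      using automorphism_involution_id [OF S automorphism_funpow [OF aut]] by blast
    then show False using least [of j] j m by simp
  qed
  \<comment> \<open>As \<open>m = 2 * j + 1\<close>, the power with exponent \<open>Suc j\<close>
    squares to \<open>a ^^ Suc m = a\<close>.\<close>
  then obtain j where j: "Suc m = Suc j + Suc j" by (metis add_Suc add_Suc_right mult_2 oddE Suc_eq_plus1)
  let ?c = "a ^^ Suc j"
  have cc: "?c (?c s) = a s" for s
  proof -
    have "?c (?c s) = (a ^^ Suc m) s" unfolding j funpow_add by simp
    then show ?thesis using m by simp
  qed
  have "\<gamma> s t = \<beta> (?c s) (?c t)" if "s \<in> carrier S" "t \<in> carrier S" for s t
    using adj [of "?c s" t "Suc j"] closed that a(2) cc by metis
  then show ?thesis using that automorphism_funpow [OF aut] by blast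
qed

section \<open>Enlarging self-orthogonal submodules by graphs of isometries\<close>

lemma larger_self_orthogonal:
  assumes S: "simple_F2G_module Gr S" and A: "submod A" and B: "submod B"
    and D: "D = A \<inter> perp A" "D = B \<inter> perp B" "D \<noteq> B" and orth: "B \<subseteq> perp A"
    and f: "factor_map S D A f" and g: "factor_map S D B g"
  obtains E where "submod E" "E \<subseteq> perp E" "D \<subset> E"
proof -
  have S': "F2G_module Gr S" using S by (simp add: simple_F2G_module_def)
  interpret S: F2G_module Gr S by (rule S')
  note fD = factor_mapD [OF f] and gD = factor_mapD [OF g]
  obtain \<beta> where \<beta>: "invariant_form S \<beta>" "\<And>x y. x \<in> A \<Longrightarrow> y \<in> A \<Longrightarrow> \<beta> (f x) (f y) = dot x y"
    using invariant_form_factor [OF S' A D(1) f] by blast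
  obtain \<gamma> where \<gamma>: "invariant_form S \<gamma>" "\<And>x y. x \<in> B \<Longrightarrow> y \<in> B \<Longrightarrow> \<gamma> (g x) (g y) = dot x y"
    using invariant_form_factor [OF S' B D(2) g] by blast
  have "finite (carrier S)" using fD(1) A by (metis finite_imageI finite_lin submod_lin)
  then obtain c where c: "automorphism S c"
    "\<And>s t. s \<in> carrier S \<Longrightarrow> t \<in> carrier S \<Longrightarrow> \<gamma> s t = \<beta> (c s) (c t)"
    using invariant_forms_isometric [OF S _ \<beta>(1) \<gamma>(1)] by blast
  have cD: "\<And>s t. s \<in> carrier S \<Longrightarrow> t \<in> carrier S \<Longrightarrow> c (s \<oplus>\<^bsub>S\<^esub> t) = c s \<oplus>\<^bsub>S\<^esub> c t"
    "\<And>s p. s \<in> carrier S \<Longrightarrow> p \<in> G \<Longrightarrow> c (act S s p) = act S (c s) p"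
    "\<And>s. s \<in> carrier S \<Longrightarrow> c s \<in> carrier S"
    using c(1) automorphism_closed [OF c(1)] by (auto simp: automorphism_def)
  have c0: "c \<zero>\<^bsub>S\<^esub> = \<zero>\<^bsub>S\<^esub>"
    using cD(1) [of "\<zero>\<^bsub>S\<^esub>" "\<zero>\<^bsub>S\<^esub>"] cD(3) [of "\<zero>\<^bsub>S\<^esub>"] S.add_self by simp
  \<comment> \<open>The vectors of \<open>A + B\<close> lying over the graph of an isometry between
    \<open>B/D\<close> and \<open>A/D\<close>. Mixed products vanish since
    \<open>B \<subseteq> perp A\<close>, and the two remaining products are equal and cancel in
    characteristic two.\<close>
  define E where "E = {x + y | x y. x \<in> A \<and> y \<in> B \<and> f x = c (g y)}"
  have A0: "0 \<in> A" "0 \<in> B" using A B by (auto simp: linD)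
  have perpA: "0 \<in> perp A" "0 \<in> perp B" by (simp_all add: perp_def)
  have f0: "f 0 = \<zero>\<^bsub>S\<^esub>" and g0: "g 0 = \<zero>\<^bsub>S\<^esub>"
    using fD(5) [of 0] gD(5) [of 0] D A0 perpA by blast+
  have DE: "D \<subseteq> E"
  proof
    fix d assume "d \<in> D"
    then have "d \<in> A" "f d = \<zero>\<^bsub>S\<^esub>" using D fD(5) by auto
    then show "d \<in> E" unfolding E_def using A0 f0 g0 c0 by (intro CollectI exI [of _ d] exI [of _ 0]) simp
  qed
  have "submod E"
    unfolding submod_def lin_def
  proof (intro conjI ballI)
    show "E \<subseteq> V"
      using linD(1) [OF submod_lin [OF A]] linD(1) [OF submod_lin [OF B]] by (auto simp: E_def intro: add_in_V)
    show "0 \<in> E" using DE D A0 perpA by blast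
    fix u assume "u \<in> E"
    then obtain x y where u: "x \<in> A" "y \<in> B" "f x = c (g y)" "u = x + y" unfolding E_def by blast
    show "u + u' \<in> E" if "u' \<in> E" for u'
    proof -
      obtain x' y' where u': "x' \<in> A" "y' \<in> B" "f x' = c (g y')" "u' = x' + y'"
        using \<open>u' \<in> E\<close> unfolding E_def by blast
      have "f (x + x') = c (g (y + y'))" using u u' fD(3) gD(2,3) cD(1) by simp
      moreover have "x + x' \<in> A" "y + y' \<in> B" using u u' A B by (simp_all add: linD)
      moreover have "u + u' = (x + x') + (y + y')" using u u' by (simp add: ac_simps)
      ultimately show ?thesis unfolding E_def by blast
    qed
    show "u \<circ> p \<in> E" if "p \<in> G" for p
    proof -
      have "f (x \<circ> p) = c (g (y \<circ> p))" using u that fD(4) gD(2,4) cD(2) by simp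
      moreover have "x \<circ> p \<in> A" "y \<circ> p \<in> B" using u that A B by (simp_all add: submod_comp)
      moreover have "u \<circ> p = (x \<circ> p) + (y \<circ> p)" using u by (simp add: comp_add)
      ultimately show ?thesis unfolding E_def by blast
    qed
  qed
  moreover have "E \<subseteq> perp E"
  proof -
    have "dot u u' = 0" if "u \<in> E" "u' \<in> E" for u u'
    proof -
      obtain x y where u: "x \<in> A" "y \<in> B" "f x = c (g y)" "u = x + y"
        using \<open>u \<in> E\<close> unfolding E_def by blast
      obtain x' y' where u': "x' \<in> A" "y' \<in> B" "f x' = c (g y')" "u' = x' + y'"
        using \<open>u' \<in> E\<close> unfolding E_def by blast
      have "dot x y' = 0" "dot y x' = 0" using u u' orth by (auto simp: perp_def dot_commute)
      moreover have "dot x x' = dot y y'"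
        using \<beta>(2) [OF u(1) u'(1)] \<gamma>(2) [OF u(2) u'(2)] c(2) u u' gD(2) by simp
      ultimately show ?thesis using u(4) u'(4) by (cases "dot y y'") (simp_all add: dot_add_left dot_add_right)
    qed
    then show ?thesis using linD(1) [OF submod_lin [OF \<open>submod E\<close>]] by (auto simp: perp_def)
  qed
  \<comment> \<open>A vector \<open>y\<close> of \<open>B\<close> outside \<open>D\<close> has a
    partner \<open>x \<in> A\<close> with \<open>x + y \<in> E\<close>. If this sum lay in
    \<open>D\<close>, then \<open>y\<close> would lie in \<open>A\<close> and in
    \<open>perp A\<close>, hence in \<open>D\<close>.\<close>
  moreover have "D \<noteq> E"
  proof
    assume DE': "D = E"
    obtain y where y: "y \<in> B" "y \<notin> D" using D by blast
    have "c (g y) \<in> f ` A" using cD(3) gD(2) y fD(1) by auto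
    then obtain x where x: "x \<in> A" "f x = c (g y)" by force
    then have "x + y \<in> A" using y DE' D unfolding E_def by blast
    then have "y \<in> A" using lin_add_cancel [OF submod_lin [OF A] x(1)] by blast
    then show False using y orth D by blast
  qed
  ultimately show ?thesis using that DE by blast
qed

text \<open>A self-orthogonal submodule of greatest size is shown to be self-dual. The hypothesis
  ranges over modules whose elements are sets of vectors, the type of the \<open>subquotient\<close>
  to which it is applied.\<close>

lemma self_dual_submod_exists:
  assumes even: "\<And>(S :: ((nat \<Rightarrow> bit) set, nat \<Rightarrow> nat) gmodule) Vs.
    simple_F2G_module Gr S \<Longrightarrow> self_dual_module Gr S \<Longrightarrow> series Vs V \<Longrightarrow> even (mult_within S Vs V)"
  obtains D where "submod D" "perp D = D"
proof -
  have "\<forall>D. submod D \<and> D \<subseteq> perp D \<longrightarrow> card D < Suc (card V)"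
    using linD(1) [OF submod_lin] card_mono [OF finite_V] by (simp add: less_Suc_eq_le)
  moreover have "submod {0} \<and> {0} \<subseteq> perp {0}" using submod_zero by simp
  ultimately obtain D where D: "submod D" "D \<subseteq> perp D"
    and greatest: "\<And>E. submod E \<Longrightarrow> E \<subseteq> perp E \<Longrightarrow> card E \<le> card D"
    using ex_has_greatest_nat [of "\<lambda>D. submod D \<and> D \<subseteq> perp D" "{0}" card "Suc (card V)"] by blast
  have max: "\<not> D \<subset> E" if "submod E" "E \<subseteq> perp E" for E
    using greatest [OF that] psubset_card_mono [of E D] that(1) by auto
  \<comment> \<open>The radical of \<open>Y\<close> is self-orthogonal and contains
    \<open>D\<close>; maximality makes it equal to \<open>D\<close>.\<close>
  have nondeg: "Y \<inter> perp Y = D" if Y: "submod Y" "D \<subseteq> Y" "Y \<subseteq> perp D" for Y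
  proof -
    have "D \<subseteq> perp Y" using perp_anti [OF Y(3)] D by simp
    moreover have "submod (Y \<inter> perp Y)" using Y submod_perp submod_Int by blast
    moreover have "Y \<inter> perp Y \<subseteq> perp (Y \<inter> perp Y)" using perp_anti [of "Y \<inter> perp Y" Y] by blast
    ultimately show ?thesis using max [of "Y \<inter> perp Y"] Y(2) by blast
  qed
  have "perp D = D"
  proof (rule ccontr)
    assume "perp D \<noteq> D"
    then have "D \<subset> perp D" using D by blast
    then obtain A where A: "cover D A" "A \<subseteq> perp D" using cover_above D submod_perp by metis
    note AD = coverD [OF A(1)]
    let ?S = "subquotient D A"
    have S: "F2G_module Gr ?S" using subquotient AD by blast
    obtain f where f: "factor_map ?S D A f" using subquotient AD by blast
    have simple: "simple_F2G_module Gr ?S" using simple_subquotient_iff AD A(1) by blast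
    have DA: "D = A \<inter> perp A" using nondeg AD A(2) by blast
    have selfdual: "self_dual_module Gr ?S"
      using invariant_form_factor [OF S AD(2) DA f] self_dual_if_invariant_form [OF S] by metis
    obtain Vs where Vs: "series Vs V" using series_exists submod_V by blast
    let ?m = "mult_within ?S Vs"
    have "?m D + ?m (perp D) = ?m V" using mult_within_perp [OF simple selfdual Vs D(1)] .
    moreover have "?m (perp D) = ?m (perp A) + 1"
      using mult_within_cover [OF S Vs cover_perp [OF A(1)]] factor_iso_perp [OF simple selfdual A(1)] f
      by (auto simp: factor_iso_def)
    moreover have "even (?m V)" using even simple selfdual Vs by blast
    \<comment> \<open>The total \<open>?m V\<close> is even and \<open>?m (perp D)\<close> exceeds
      \<open>?m (perp A)\<close> by one, so the two numbers differ in parity. By monotonicity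
      \<open>perp A\<close> then contains a copy of the factor beyond those in
      \<open>D\<close>.\<close>
    ultimately have "?m D \<noteq> ?m (perp A)" by (metis even_Suc odd_add Suc_eq_plus1)
    moreover have "D \<subseteq> perp A" using DA by blast
    ultimately have less: "?m D < ?m (perp A)" using mult_within_mono [of D "perp A" ?S Vs] by (simp add: le_neq_implies_less)
    \<comment> \<open>A surplus in multiplicity yields a copy of \<open>?S\<close> directly above
      \<open>D\<close>. If a cover \<open>B\<close> of \<open>D\<close> in \<open>Y\<close> is not
      such a copy, the orthogonal complement of \<open>B\<close> in \<open>Y\<close> has the same
      multiplicity and is smaller.\<close>
    have occurs: "\<exists>B. cover D B \<and> B \<subseteq> Y \<and> factor_iso ?S D B"
      if "submod Y" "D \<subseteq> Y" "Y \<subseteq> perp D" "?m D < ?m Y" for Y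
      using that
    proof (induction "card Y" arbitrary: Y rule: less_induct)
      case less
      have "D \<subset> Y" using less.prems by blast
      then obtain B where B: "cover D B" "B \<subseteq> Y" using cover_above D less.prems by metis
      note BD = coverD [OF B(1)]
      show ?case
      proof (cases "factor_iso ?S D B")
        case True
        then show ?thesis using B by blast
      next
        case False
        define Y' where "Y' = Y \<inter> perp B"
        have DB: "B \<inter> perp B = D" using nondeg BD B less.prems by blast
        have Y': "submod Y'" using less.prems BD submod_perp submod_Int by (simp add: Y'_def)
        have DY': "D \<subseteq> Y'" using DB less.prems by (auto simp: Y'_def)
        have BY': "B \<inter> Y' = D" using DB B by (auto simp: Y'_def)
        have sum: "Y = B + Y'"
        proof
          show "B + Y' \<subseteq> Y" using plus_subset [of Y] less.prems B by (auto simp: Y'_def)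
          show "Y \<subseteq> B + Y'"
          proof
            fix y assume y: "y \<in> Y"
            \<comment> \<open>Dualizing \<open>B \<inter> perp B = D\<close>: modulo
              \<open>D\<close> the nondegenerate \<open>B\<close> splits off orthogonally.\<close>
            have "perp D = B + perp B"
              using perp_Int [of B "perp B"] DB BD(2) by (simp add: add.commute)
            then have "y \<in> B + perp B" using y less.prems by blast
            then obtain b b' where b: "b \<in> B" "b' \<in> perp B" "y = b + b'" by (auto elim!: set_plus_elim)
            then have "b' \<in> Y" using lin_add_cancel [of Y b b'] y B less.prems by auto
            then show "y \<in> B + Y'" using b by (auto simp: Y'_def)
          qed
        qed
        \<comment> \<open>By the modular law a submodule \<open>H\<close> between \<open>Y'\<close>
          and \<open>Y\<close> is determined by \<open>H \<inter> B\<close>, which lies between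
          \<open>D\<close> and \<open>B\<close>.\<close>
        have "cover Y' Y"
          unfolding cover_def
        proof (intro conjI allI impI)
          show "Y' \<subset> Y"
          proof -
            have "B \<noteq> D" using BD(3) by blast
            then have "Y' \<noteq> Y" using BY' B by blast
            then show ?thesis by (auto simp: Y'_def)
          qed
          fix H assume H: "submod H" "Y' \<subseteq> H" "H \<subseteq> Y"
          have "H \<inter> B = D \<or> H \<inter> B = B"
            using BD(4) [of "H \<inter> B"] submod_Int H BD(2,3) DY' by blast
          have modular: "H \<subseteq> (H \<inter> B) + Y'"
          proof
            fix h assume h: "h \<in> H"
            then have "h \<in> B + Y'" using H sum by blast
            then obtain b y where b: "b \<in> B" "y \<in> Y'" "h = b + y" by (auto elim!: set_plus_elim)
            then have "b \<in> H" using lin_add_cancel' [of H y b] h H by auto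
            then show "h \<in> (H \<inter> B) + Y'" using b by auto
          qed
          from \<open>H \<inter> B = D \<or> H \<inter> B = B\<close> show "H = Y' \<or> H = Y"
          proof
            assume "H \<inter> B = D"
            then have "H \<subseteq> Y'" using modular plus_subset [of Y' D Y'] Y' DY' by auto
            then show ?thesis using H(2) by blast
          next
            assume "H \<inter> B = B"
            then have "B + Y' \<subseteq> H" using plus_subset [of H B Y'] H by auto
            then show ?thesis using H(3) sum by blast
          qed
        qed (use Y' less.prems in auto)
        moreover have "factor_iso ?S D B \<longleftrightarrow> factor_iso ?S Y' Y"
          using factor_iso_second_isomorphism [OF S Y' BD(2)] BY' sum by metis
        ultimately have "?m Y = ?m Y'" using mult_within_cover [OF S Vs] False by simp
        moreover have "card Y' < card Y"
          using \<open>cover Y' Y\<close> less.prems by (intro psubset_card_mono) (auto simp: cover_def)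
        ultimately obtain B' where "cover D B'" "B' \<subseteq> Y'" "factor_iso ?S D B'"
          using less.hyps [of Y'] Y' DY' less.prems by (auto simp: Y'_def)
        then show ?thesis by (auto simp: Y'_def)
      qed
    qed
    have "perp A \<subseteq> perp D" using perp_anti AD(3) by blast
    then obtain B where B: "cover D B" "B \<subseteq> perp A" "factor_iso ?S D B"
      using occurs [of "perp A"] less \<open>D \<subseteq> perp A\<close> submod_perp [OF AD(2)] by blast
    note BD = coverD [OF B(1)]
    obtain g where g: "factor_map ?S D B g" using B(3) by (auto simp: factor_iso_def)
    have "D = B \<inter> perp B" using nondeg [of B] BD B(2) \<open>perp A \<subseteq> perp D\<close> by blast
    then obtain E where "submod E" "E \<subseteq> perp E" "D \<subset> E"
      using larger_self_orthogonal [OF simple AD(2) BD(2) DA _ _ B(2) f g] BD(3) by blast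
    then show False using max by blast
  qed
  then show ?thesis using that D by blast
qed

end

section \<open>The equivalence in terms of Type II codes and series of covers\<close>

theorem theorem5p2:
  fixes n :: nat and G :: "(nat \<Rightarrow> nat) set"
  assumes "subgroup G (sym_group n)"
  shows "(\<exists>C. linear_code n C \<and> self_dual_code n C \<and> doubly_even_code n C \<and> G \<subseteq> Aut_code n C)
    \<longleftrightarrow>
      8 dvd n \<and>
      (\<forall>S :: ((nat \<Rightarrow> bit) set, nat \<Rightarrow> nat) gmodule.
         simple_F2G_module ((sym_group n)\<lparr>carrier := G\<rparr>) S \<and>
         self_dual_module ((sym_group n)\<lparr>carrier := G\<rparr>) S \<and>
         composition_factor ((sym_group n)\<lparr>carrier := G\<rparr>) S (perm_module n) \<longrightarrow>
         (\<forall>Vs. composition_series ((sym_group n)\<lparr>carrier := G\<rparr>) (perm_module n) Vs \<longrightarrow>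
            even (multiplicity_in_series ((sym_group n)\<lparr>carrier := G\<rparr>) S (perm_module n) Vs))) \<and>
      G \<subseteq> carrier (alt_group n)"
    (is "?L \<longleftrightarrow> 8 dvd n \<and> ?even \<and> ?alt")
proof -
  interpret perm_action n G by (rule perm_action.intro [OF assms])
  have code_iff: "linear_code n C \<and> self_dual_code n C \<and> doubly_even_code n C \<longleftrightarrow> type_II C" for C
    by (auto simp: linear_code_iff self_dual_code_def doubly_even_code_iff type_II_def doubly_even_def)
  have Aut_iff: "G \<subseteq> Aut_code n C \<longleftrightarrow> (\<forall>p\<in>G. move p C = C)" for C
    using subgroup.subset [OF assms] by (auto simp: Aut_code_def perm_module_simps)
  show ?thesis
  proof
    assume ?L
    then obtain C where C: "type_II C" "\<And>p. p \<in> G \<Longrightarrow> move p C = C"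
      using code_iff Aut_iff by blast
    have sub: "submod C" using C unfolding submod_def by (auto simp: type_II_def doubly_even_def)
    have "perp C = C" using C by (simp add: type_II_def)
    have "even (multiplicity_in_series Gr S (perm_module n) Vs)"
      if "simple_F2G_module Gr S" "self_dual_module Gr S" "composition_series Gr (perm_module n) Vs"
      for S :: "((nat \<Rightarrow> bit) set, nat \<Rightarrow> nat) gmodule" and Vs
    proof -
      have Vs: "series Vs V" using that composition_series_iff by blast
      \<comment> \<open>As \<open>C\<close> is its own dual, both summands in
        \<open>mult_within_perp\<close> coincide.\<close>
      have "mult_within S Vs V = 2 * mult_within S Vs C"
        using mult_within_perp [OF that(1,2) Vs sub] \<open>perp C = C\<close> by simp
      then show ?thesis
        using multiplicity_in_series_eq [of S Vs] Vs that(1) by (simp add: simple_F2G_module_def)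
    qed
    moreover have ?alt
    proof
      fix p assume "p \<in> G"
      then show "p \<in> carrier (alt_group n)"
        using type_II_stabilizer_even [OF G_permutes C(1) C(2)] G_permutes by (simp only: alt_group_carrier)
    qed
    ultimately show "8 dvd n \<and> ?even \<and> ?alt" using type_II_length C(1) by blast
  next
    assume R: "8 dvd n \<and> ?even \<and> ?alt"
    have even: "even (mult_within S Vs V)"
      if S: "simple_F2G_module Gr S" "self_dual_module Gr S" and Vs: "series Vs V"
      for S :: "((nat \<Rightarrow> bit) set, nat \<Rightarrow> nat) gmodule" and Vs
    proof (cases "composition_factor Gr S (perm_module n)")
      case True
      then have "even (multiplicity_in_series Gr S (perm_module n) Vs)"
        using R S Vs composition_series_iff by blast
      then show ?thesis
        using multiplicity_in_series_eq [of S Vs] Vs S(1) by (simp add: simple_F2G_module_def)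
    next
      case False
      \<comment> \<open>Condition (b) speaks of composition factors only; any other simple module
        occurs in no step, and zero is even.\<close>
      then have "multiplicity_in_series Gr S (perm_module n) Vs = 0"
        using Vs composition_series_iff unfolding composition_factor_def multiplicity_in_series_def
        by (metis (mono_tags, lifting) card.empty empty_Collect_eq)
      then show ?thesis
        using multiplicity_in_series_eq [of S Vs] Vs S(1) by (simp add: simple_F2G_module_def)
    qed
    \<comment> \<open>Condition (b) provides an invariant self-dual code; conditions (a) and (c)
      then turn it into an invariant doubly-even one.\<close>
    obtain D where D: "submod D" "perp D = D" using self_dual_submod_exists even by blast
    have "p permutes {1..n} \<and> evenperm p \<and> move p D \<subseteq> D" if "p \<in> G" for p
    proof -
      have "p permutes {1..n} \<and> evenperm p" using R that alt_group_carrier by blast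
      then show ?thesis using submod_comp [OF D(1) _ that] by blast
    qed
    then obtain E where "type_II E" "\<And>p. p \<in> G \<Longrightarrow> move p E = E"
      using type_II_if_self_dual [OF _ submod_lin [OF D(1)] D(2)] R by blast
    then show ?L using code_iff Aut_iff by blast
  qed
qed

end
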